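(* Consider pairs $(f,\{n_p\})$ where $f(z)=h(z)+\overline{g(z)}=\sum_{k=0}^{\infty}a_kz^k+\overline{\sum_{k=1}^{\infty}b_kz^k}$ is harmonic in $\mathbb{D}$ and $\{n_p\}_{p=1}^{\infty}$ is a strictly increasing sequence of nonnegative integers such that for every $p$ $$\frac{f^{(n_p)}-n_p!\,a_{n_p}-n_p!\,\overline{b_{n_p}}}{(n_p+1)!\,a_{n_p+1}}\in\mathcal{S}_H^{c}\quad\text{if }|a_{n_p+1}|\ge|b_{n_p+1}|,$$ and $$\frac{\overline{f^{(n_p)}}-n_p!\,\overline{a_{n_p}}-n_p!\,b_{n_p}}{(n_p+1)!\,b_{n_p+1}}\in\mathcal{S}_H^{c}\quad\text{if }|a_{n_p+1}|\le|b_{n_p+1}|.$$ Define $\rho^{*}\in[1,\infty]$ by $$\frac{1}{\rho^{*}}=1-\limsup_{p\to\infty}\frac{\log(n_p-n_{p-1})}{\log n_p}.$$ (a) For every such pair with $\rho^{*}<\infty$, $f$ is a harmonic entire mapping of order no greater than $\rho^{*}$. (b) If $\rho^{*}=\infty$, then $f$ need not be harmonic entire, and if it is harmonic entire then it may be of any order; that is, there exists such a pair with $\rho^{*}=\infty$ for which $f$ is not harmonic entire, and for every $\rho\in[0,\infty]$ there exists such a pair with $\rho^{*}=\infty$ for which $f$ is harmonic entire of order $\rho$.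
   Context: Let $\mathbb{D}=\{z\in\mathbb{C}:|z|<1\}$. A harmonic mapping $F=H+\overline{G}$ ($H,G$ analytic) is sense-preserving if $G'=\omega H'$ for some analytic $\omega$ with $|\omega|<1$ and $F$ is nonconstant. $\mathcal{S}_H$ is the class of all univalent (injective) sense-preserving harmonic mappings $F=H+\overline{G}$ in $\mathbb{D}$ with $H(z)=z+\sum_{n=2}^{\infty}A_nz^n$ and $G(z)=\sum_{n=1}^{\infty}B_nz^n$. $\mathcal{S}_H^{c}$ is the family of $F\in\mathcal{S}_H$ whose coefficients satisfy $|A_n|<\frac{2n^2+1}{3}$ and $|B_n|<\frac{2n^2+1}{3}$ for all $n\ge2$. For $n\ge0$, $f^{(n)}:=h^{(n)}+\overline{g^{(n)}}$ (with $f^{(0)}=f$), and $b_0=0$. $f$ is a harmonic entire mapping if it is (extends to) a complex-valued harmonic function on $\mathbb{C}$; with $M(r,f)=\max_{|z|=r}|f(z)|$ its order is $\limsup_{r\to\infty}\frac{\log\log M(r,f)}{\log r}\in[0,\infty]$. Convention: $\rho^*=\infty$ when the limsup equals $1$. *)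

theory Defs
  imports "HOL-Complex_Analysis.Complex_Analysis"
begin

section \<open>Harmonic functions\<close>

text \<open>
  \<open>f\<close> is continuously (real) differentiable on the open set \<open>S\<close>, with partial derivatives
  \<open>fx\<close> and \<open>fy\<close> with respect to the real and imaginary part of the argument.
\<close>

definition has_C1_partials_on ::
  "(complex \<Rightarrow> complex) \<Rightarrow> (complex \<Rightarrow> complex) \<Rightarrow> (complex \<Rightarrow> complex) \<Rightarrow> complex set \<Rightarrow> bool" where
  "has_C1_partials_on f fx fy S \<longleftrightarrow>
     continuous_on S fx \<and> continuous_on S fy \<and>
     (\<forall>z\<in>S. (f has_derivative (\<lambda>v. Re v *\<^sub>R fx z + Im v *\<^sub>R fy z)) (at z))"

definition harmonic_on :: "(complex \<Rightarrow> complex) \<Rightarrow> complex set \<Rightarrow> bool" where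
  "harmonic_on f S \<longleftrightarrow>
     (\<exists>fx fy fxx fxy fyx fyy.
        has_C1_partials_on f fx fy S \<and>
        has_C1_partials_on fx fxx fxy S \<and>
        has_C1_partials_on fy fyx fyy S \<and>
        (\<forall>z\<in>S. fxx z + fyy z = 0))"

text \<open>
  The canonical decomposition \<open>f = h + cnj g\<close> in the unit disc, with the power series of \<open>h\<close> and \<open>g\<close>.
  The normalisation \<open>b 0 = 0\<close> makes \<open>h\<close>, \<open>g\<close> (on the disc) and \<open>a\<close>, \<open>b\<close> unique for given \<open>f\<close>.
\<close>

definition harmonic_expansion ::
  "(complex \<Rightarrow> complex) \<Rightarrow> (complex \<Rightarrow> complex) \<Rightarrow> (complex \<Rightarrow> complex) \<Rightarrow>
   (nat \<Rightarrow> complex) \<Rightarrow> (nat \<Rightarrow> complex) \<Rightarrow> bool" where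
  "harmonic_expansion f h g a b \<longleftrightarrow>
     h holomorphic_on ball 0 1 \<and> g holomorphic_on ball 0 1 \<and>
     (\<forall>z\<in>ball 0 1. f z = h z + cnj (g z) \<and>
        (\<lambda>k. a k * z ^ k) sums h z \<and> (\<lambda>k. b k * z ^ k) sums g z) \<and>
     b 0 = 0"

section \<open>Univalent harmonic mappings of the unit disc\<close>

definition sense_preserving ::
  "(complex \<Rightarrow> complex) \<Rightarrow> (complex \<Rightarrow> complex) \<Rightarrow> (complex \<Rightarrow> complex) \<Rightarrow> bool" where
  "sense_preserving F H G \<longleftrightarrow>
     (\<exists>\<omega>. \<omega> holomorphic_on ball 0 1 \<and>
        (\<forall>z\<in>ball 0 1. norm (\<omega> z) < 1 \<and> deriv G z = \<omega> z * deriv H z)) \<and>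
     \<not> F constant_on ball 0 1"

text \<open>Only the values in the unit disc decide membership in the classes below.\<close>

definition S_H :: "(complex \<Rightarrow> complex) set" where
  "S_H = {F. \<exists>H G A B. harmonic_expansion F H G A B \<and> A 0 = 0 \<and> A 1 = 1 \<and>
             sense_preserving F H G \<and> inj_on F (ball 0 1)}"

definition S_Hc :: "(complex \<Rightarrow> complex) set" where
  "S_Hc = {F \<in> S_H. \<exists>H G A B. harmonic_expansion F H G A B \<and>
             (\<forall>n\<ge>2. norm (A n) < (2 * real n ^ 2 + 1) / 3 \<and>
                    norm (B n) < (2 * real n ^ 2 + 1) / 3)}"

section \<open>Pairs with univalent derivatives\<close>

definition harmonic_deriv ::
  "nat \<Rightarrow> (complex \<Rightarrow> complex) \<Rightarrow> (complex \<Rightarrow> complex) \<Rightarrow> complex \<Rightarrow> complex" where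
  "harmonic_deriv n h g z = (deriv ^^ n) h z + cnj ((deriv ^^ n) g z)"

text \<open>
  The sequence is indexed from 0. If \<open>a (n p + 1) = b (n p + 1) = 0\<close>, the quotients below
  are the zero function, which is not injective; so such an index is excluded.
\<close>

definition admissible_pair :: "(complex \<Rightarrow> complex) \<Rightarrow> (nat \<Rightarrow> nat) \<Rightarrow> bool" where
  "admissible_pair f n \<longleftrightarrow>
     harmonic_on f (ball 0 1) \<and> strict_mono n \<and>
     (\<exists>h g a b. harmonic_expansion f h g a b \<and>
       (\<forall>p.
         (norm (a (n p + 1)) \<ge> norm (b (n p + 1)) \<longrightarrow>
            (\<lambda>z. (harmonic_deriv (n p) h g z - fact (n p) * a (n p) - fact (n p) * cnj (b (n p)))
                 / (fact (n p + 1) * a (n p + 1))) \<in> S_Hc) \<and>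
         (norm (a (n p + 1)) \<le> norm (b (n p + 1)) \<longrightarrow>
            (\<lambda>z. (cnj (harmonic_deriv (n p) h g z) - fact (n p) * cnj (a (n p)) - fact (n p) * b (n p))
                 / (fact (n p + 1) * b (n p + 1))) \<in> S_Hc)))"

text \<open>Division in \<^typ>\<open>ereal\<close> gives \<open>1 / 0 = \<infinity>\<close>, which is the intended value when the limsup is 1.\<close>

definition rho_star :: "(nat \<Rightarrow> nat) \<Rightarrow> ereal" where
  "rho_star n =
     1 / (1 - limsup (\<lambda>p. ereal (ln (real (n (Suc p)) - real (n p)) / ln (real (n (Suc p))))))"

section \<open>Harmonic entire mappings and their order\<close>

text \<open>
  \<open>F\<close> is the harmonic extension to the plane of the function \<open>f\<close> on the unit disc; it is unique
  if it exists.
\<close>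

definition harmonic_entire_extension :: "(complex \<Rightarrow> complex) \<Rightarrow> (complex \<Rightarrow> complex) \<Rightarrow> bool" where
  "harmonic_entire_extension f F \<longleftrightarrow> harmonic_on F UNIV \<and> (\<forall>z\<in>ball 0 1. F z = f z)"

definition harmonic_entire :: "(complex \<Rightarrow> complex) \<Rightarrow> bool" where
  "harmonic_entire f \<longleftrightarrow> (\<exists>F. harmonic_entire_extension f F)"

definition max_modulus :: "real \<Rightarrow> (complex \<Rightarrow> complex) \<Rightarrow> real" where
  "max_modulus r F = (SUP z\<in>sphere 0 r. norm (F z))"

definition growth_order :: "(complex \<Rightarrow> complex) \<Rightarrow> ereal" where
  "growth_order F = Limsup at_top (\<lambda>r::real. ereal (ln (ln (max_modulus r F)) / ln r))"

end

theory Submission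
  imports Defs "HOL-Real_Asymp.Real_Asymp"
begin

text \<open>
  For part (a), put \<open>M j = j! max(|a\<^sub>j|, |b\<^sub>j|)\<close>. The coefficient bounds in \<open>S_Hc\<close> give
  \<open>M (n\<^sub>p + k) \<le> k\<^sup>2 k! M (n\<^sub>p + 1)\<close>, hence each gap \<open>d\<close> multiplies \<open>M\<close> by at most \<open>(8 d)\<^sup>d\<close>.
  If a gap ending at \<open>n\<close> is eventually at most \<open>n\<^bsup>\<beta>\<^esup>\<close>, these factors multiply up to \<open>M j \<le> C (16 j\<^bsup>\<beta>\<^esup>)\<^sup>j\<close>, so the
  coefficients are at most \<open>C (48 / j\<^bsup>1-\<beta>\<^esup>)\<^sup>j\<close> and the order is at most \<open>1 / (1 - \<beta>)\<close>.

  For part (b), take a lacunary series \<open>\<Sum>q. \<phi>(N\<^sub>q)\<^bsup>-N\<^sub>q\<^esup> z\<^bsup>N\<^sub>q\<^esup>\<close> and \<open>n\<^sub>q = N\<^sub>q - 1\<close>, with \<open>N\<^sub>q\<close>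
  growing so fast that every normalised derivative is a tiny perturbation of the identity. The choice
  \<open>\<phi> = 4\<close> has radius of convergence 4, while \<open>\<phi> k = e\<^sup>k, k\<^bsup>1/\<rho>\<^esup>, ln k\<close> give the orders
  \<open>0, \<rho>, \<infinity>\<close>.
\<close>

section \<open>Harmonic functions and holomorphic functions\<close>

lemma has_C1_partials_on_holomorphic_plus_cnj:
  assumes "open S" "h holomorphic_on S" "g holomorphic_on S"
  shows "has_C1_partials_on (\<lambda>z. h z + cnj (g z))
           (\<lambda>z. deriv h z + cnj (deriv g z)) (\<lambda>z. \<i> * deriv h z + cnj (\<i> * deriv g z)) S"
  unfolding has_C1_partials_on_def
proof (intro conjI ballI)
  have c: "continuous_on S (deriv h)" "continuous_on S (deriv g)"
    using assms by (auto intro!: holomorphic_on_imp_continuous_on holomorphic_deriv)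
  show "continuous_on S (\<lambda>z. deriv h z + cnj (deriv g z))"
    by (intro continuous_intros c)
  show "continuous_on S (\<lambda>z. \<i> * deriv h z + cnj (\<i> * deriv g z))"
    by (intro continuous_intros c)
  fix z assume z: "z \<in> S"
  have h: "(h has_derivative (\<lambda>v. deriv h z * v)) (at z)"
    and g: "(g has_derivative (\<lambda>v. deriv g z * v)) (at z)"
    using assms z holomorphic_derivI by (auto simp flip: has_field_derivative_def)
  have "((\<lambda>z. h z + cnj (g z)) has_derivative (\<lambda>v. deriv h z * v + cnj (deriv g z * v))) (at z)"
    by (intro derivative_intros h g)
  also have "(\<lambda>v. deriv h z * v + cnj (deriv g z * v)) =
    (\<lambda>v. Re v *\<^sub>R (deriv h z + cnj (deriv g z)) + Im v *\<^sub>R (\<i> * deriv h z + cnj (\<i> * deriv g z)))"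
    by (auto simp: fun_eq_iff complex_eq_iff algebra_simps)
  finally show "((\<lambda>z. h z + cnj (g z)) has_derivative \<dots>) (at z)" .
qed

text \<open>Both first partials are again a holomorphic function plus a conjugated one, so the
  preceding lemma applies to them as well. Each y-derivative puts a factor \<open>\<i>\<close> in
  front of the holomorphic derivatives; two of them produce the minus sign in the Laplace
  equation.\<close>

lemma harmonic_on_holomorphic_plus_cnj:
  assumes S: "open S" and h: "h holomorphic_on S" and g: "g holomorphic_on S"
  shows "harmonic_on (\<lambda>z. h z + cnj (g z)) S"
proof -
  have h': "deriv h holomorphic_on S" and g': "deriv g holomorphic_on S"
    using assms by (auto intro: holomorphic_deriv)
  have d: "deriv (\<lambda>z. \<i> * deriv h z) z = \<i> * deriv (deriv h) z"
          "deriv (\<lambda>z. \<i> * deriv g z) z = \<i> * deriv (deriv g) z" if "z \<in> S" for z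
    using h' g' S that by (auto intro!: deriv_cmult simp: holomorphic_on_imp_differentiable_at)
  note C = has_C1_partials_on_holomorphic_plus_cnj[OF S]
  have "has_C1_partials_on (\<lambda>z. \<i> * deriv h z + cnj (\<i> * deriv g z))
           (\<lambda>z. deriv (\<lambda>z. \<i> * deriv h z) z + cnj (deriv (\<lambda>z. \<i> * deriv g z) z))
           (\<lambda>z. \<i> * deriv (\<lambda>z. \<i> * deriv h z) z + cnj (\<i> * deriv (\<lambda>z. \<i> * deriv g z) z)) S"
    by (intro C holomorphic_intros h' g')
  with C[OF h g] C[OF h' g'] show ?thesis
    unfolding harmonic_on_def by (fastforce simp: d)
qed

text \<open>Two uses of the mean value theorem, first in x and then in y. The second difference is
  symmetric in the variables, so exchanging their roles expresses the same number through the other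
  mixed partial.\<close>

lemma second_difference_mvt:
  fixes u ux uxy :: "real \<Rightarrow> real \<Rightarrow> real"
  assumes ux: "\<And>x y. ((\<lambda>x. u x y) has_real_derivative ux x y) (at x)"
    and uxy: "\<And>x y. ((\<lambda>y. ux x y) has_real_derivative uxy x y) (at y)"
    and t: "0 < t"
  obtains \<xi> \<eta> where "x < \<xi>" "\<xi> < x + t" "y < \<eta>" "\<eta> < y + t"
    "u (x + t) (y + t) - u (x + t) y - u x (y + t) + u x y = t\<^sup>2 * uxy \<xi> \<eta>"
proof -
  have "((\<lambda>x. u x (y + t) - u x y) has_real_derivative (ux s (y + t) - ux s y)) (at s)" for s
    by (intro derivative_intros ux)
  then obtain \<xi> where \<xi>: "x < \<xi>" "\<xi> < x + t"
    "(u (x + t) (y + t) - u (x + t) y) - (u x (y + t) - u x y) = (x + t - x) * (ux \<xi> (y + t) - ux \<xi> y)"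
    using MVT2[of x "x + t" "\<lambda>x. u x (y + t) - u x y" "\<lambda>s. ux s (y + t) - ux s y"] t by auto
  obtain \<eta> where \<eta>: "y < \<eta>" "\<eta> < y + t" "ux \<xi> (y + t) - ux \<xi> y = (y + t - y) * uxy \<xi> \<eta>"
    using MVT2[of y "y + t" "ux \<xi>" "uxy \<xi>"] t uxy by auto
  show ?thesis
    using \<xi> \<eta> by (intro that[of \<xi> \<eta>]) (auto simp: power2_eq_square)
qed

text \<open>Schwarz's theorem. On each square with corner (x, y) and side t, both mixed partials
  attain the second difference divided by the square of t; continuity at the corner equates them as
  t tends to 0.\<close>

lemma mixed_partials_eq_real:
  fixes u ux uy uxy uyx :: "real \<Rightarrow> real \<Rightarrow> real"
  assumes ux: "\<And>x y. ((\<lambda>x. u x y) has_real_derivative ux x y) (at x)"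
    and uxy: "\<And>x y. ((\<lambda>y. ux x y) has_real_derivative uxy x y) (at y)"
    and uy: "\<And>x y. ((\<lambda>y. u x y) has_real_derivative uy x y) (at y)"
    and uyx: "\<And>x y. ((\<lambda>x. uy x y) has_real_derivative uyx x y) (at x)"
    and cont: "isCont (\<lambda>p. uxy (fst p) (snd p)) (x, y)" "isCont (\<lambda>p. uyx (fst p) (snd p)) (x, y)"
  shows "uxy x y = uyx x y"
proof -
  have "\<exists>p q. p \<in> {x..x+t} \<times> {y..y+t} \<and> q \<in> {x..x+t} \<times> {y..y+t} \<and>
          uxy (fst p) (snd p) = uyx (fst q) (snd q)" if t: "0 < t" for t
  proof -
    obtain \<xi> \<eta> where 1: "x < \<xi>" "\<xi> < x + t" "y < \<eta>" "\<eta> < y + t"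
      "u (x + t) (y + t) - u (x + t) y - u x (y + t) + u x y = t\<^sup>2 * uxy \<xi> \<eta>"
      using second_difference_mvt[of u ux uxy t x y] ux uxy t by metis
    obtain \<eta>' \<xi>' where 2: "y < \<eta>'" "\<eta>' < y + t" "x < \<xi>'" "\<xi>' < x + t"
      "u (x + t) (y + t) - u x (y + t) - u (x + t) y + u x y = t\<^sup>2 * uyx \<xi>' \<eta>'"
      using second_difference_mvt[of "\<lambda>y x. u x y" "\<lambda>y x. uy x y" "\<lambda>y x. uyx x y" t y x] uy uyx t
      by metis
    have "t\<^sup>2 * uxy \<xi> \<eta> = t\<^sup>2 * uyx \<xi>' \<eta>'"
      using 1(5) 2(5) by linarith
    then have "uxy \<xi> \<eta> = uyx \<xi>' \<eta>'"
      using t by simp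
    then show ?thesis
      using 1 2 by (intro exI[of _ "(\<xi>, \<eta>)"] exI[of _ "(\<xi>', \<eta>')"]) auto
  qed
  then have "\<forall>n. \<exists>p q. p \<in> {x..x+1/Suc n} \<times> {y..y+1/Suc n} \<and> q \<in> {x..x+1/Suc n} \<times> {y..y+1/Suc n} \<and>
          uxy (fst p) (snd p) = uyx (fst q) (snd q)"
    by simp
  then obtain p q where pq: "\<And>n. p n \<in> {x..x+1/Suc n} \<times> {y..y+1/Suc n}"
      "\<And>n. q n \<in> {x..x+1/Suc n} \<times> {y..y+1/Suc n}"
      "\<And>n. uxy (fst (p n)) (snd (p n)) = uyx (fst (q n)) (snd (q n))"
    by metis
  have lim: "r \<longlonglongrightarrow> (x, y)"
    if r: "\<And>n. r n \<in> {x..x+1/Suc n} \<times> {y..y+1/Suc n}" for r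
  proof -
    have up: "(\<lambda>n. a + 1 / real (Suc n)) \<longlonglongrightarrow> a" for a
      by real_asymp
    have "(\<lambda>n. fst (r n)) \<longlonglongrightarrow> x"
      by (rule tendsto_sandwich[OF _ _ tendsto_const up]) (use r in \<open>auto simp: mem_Times_iff\<close>)
    moreover have "(\<lambda>n. snd (r n)) \<longlonglongrightarrow> y"
      by (rule tendsto_sandwich[OF _ _ tendsto_const up]) (use r in \<open>auto simp: mem_Times_iff\<close>)
    ultimately show ?thesis
      using tendsto_Pair by fastforce
  qed
  have "(\<lambda>n. uxy (fst (p n)) (snd (p n))) \<longlonglongrightarrow> uxy x y"
    using isCont_tendsto_compose[OF cont(1) lim[OF pq(1)]] by simp
  moreover have "(\<lambda>n. uxy (fst (p n)) (snd (p n))) \<longlonglongrightarrow> uyx x y"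
    using isCont_tendsto_compose[OF cont(2) lim[OF pq(2)]] by (simp add: pq(3))
  ultimately show ?thesis
    by (rule LIMSEQ_unique)
qed

text \<open>Composition with a real functional \<open>L\<close>, later \<open>Re\<close> or
  \<open>Im\<close>, reduces complex functions to real functions of two real variables.\<close>

lemma has_derivative_along_axes:
  assumes "(f has_derivative (\<lambda>v. Re v *\<^sub>R p + Im v *\<^sub>R q)) (at (Complex x y))"
    and "bounded_linear L"
  shows "((\<lambda>s. L (f (Complex s y))) has_real_derivative L p) (at x)"
    and "((\<lambda>s. L (f (Complex x s))) has_real_derivative L q) (at y)"
proof -
  interpret L: bounded_linear L by fact
  have c: "((\<lambda>s. Complex s y) has_derivative (\<lambda>v. of_real v)) (at x)"
    "((\<lambda>s. Complex x s) has_derivative (\<lambda>v. \<i> * of_real v)) (at y)"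
    unfolding Complex_eq by (auto intro!: derivative_eq_intros)
  show "((\<lambda>s. L (f (Complex s y))) has_real_derivative L p) (at x)"
    unfolding has_field_derivative_def
    using L.has_derivative[OF has_derivative_compose[OF c(1) assms(1)]]
    by (rule has_derivative_eq_rhs) (auto simp: L.scaleR)
  show "((\<lambda>s. L (f (Complex x s))) has_real_derivative L q) (at y)"
    unfolding has_field_derivative_def
    using L.has_derivative[OF has_derivative_compose[OF c(2) assms(1)]]
    by (rule has_derivative_eq_rhs) (auto simp: L.scaleR)
qed

lemma mixed_partials_eq:
  assumes "has_C1_partials_on f fx fy UNIV" "has_C1_partials_on fx fxx fxy UNIV"
    "has_C1_partials_on fy fyx fyy UNIV"
  shows "fxy z = fyx z"
proof -
  have *: "L (fxy z) = L (fyx z)" if L: "bounded_linear (L :: complex \<Rightarrow> real)" for L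
  proof -
    note D = has_derivative_along_axes[OF _ L]
    have c: "isCont (\<lambda>p. L (k (Complex (fst p) (snd p)))) q" if "continuous_on UNIV k" for k q
    proof -
      have "isCont (\<lambda>p. Complex (fst p) (snd p)) q"
        unfolding Complex_eq by (intro continuous_intros)
      moreover have "isCont (\<lambda>z. L (k z)) (Complex (fst q) (snd q))"
        using that by (intro bounded_linear.isCont[OF L]) (simp add: continuous_on_eq_continuous_at)
      ultimately show ?thesis
        by (rule isCont_o2)
    qed
    have "L (fxy (Complex (Re z) (Im z))) = L (fyx (Complex (Re z) (Im z)))"
    proof (rule mixed_partials_eq_real[where u = "\<lambda>x y. L (f (Complex x y))"
          and ux = "\<lambda>x y. L (fx (Complex x y))" and uy = "\<lambda>x y. L (fy (Complex x y))"
          and uxy = "\<lambda>x y. L (fxy (Complex x y))" and uyx = "\<lambda>x y. L (fyx (Complex x y))"])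
    qed (use assms in \<open>auto simp: has_C1_partials_on_def intro!: D c\<close>)
    then show ?thesis by simp
  qed
  show ?thesis
    using *[OF bounded_linear_Re] *[OF bounded_linear_Im] by (rule complex_eqI)
qed

text \<open>\<open>f\<^sub>x - \<i> f\<^sub>y\<close> is twice the Wirtinger derivative of \<open>f\<close>; harmonicity is its Cauchy--Riemann equation.\<close>

lemma harmonic_wirtinger_derivative_entire:
  assumes f: "has_C1_partials_on f fx fy UNIV" and fx: "has_C1_partials_on fx fxx fxy UNIV"
    and fy: "has_C1_partials_on fy fyx fyy UNIV" and lap: "\<And>z. fxx z + fyy z = 0"
  shows "(\<lambda>z. fx z - \<i> * fy z) holomorphic_on UNIV"
proof -
  have "((\<lambda>z. fx z - \<i> * fy z) has_field_derivative (fxx z - \<i> * fyx z)) (at z)" for z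
  proof -
    have 1: "(fx has_derivative (\<lambda>v. Re v *\<^sub>R fxx z + Im v *\<^sub>R fxy z)) (at z)"
      "(fy has_derivative (\<lambda>v. Re v *\<^sub>R fyx z + Im v *\<^sub>R fyy z)) (at z)"
      using fx fy by (auto simp: has_C1_partials_on_def)
    have e: "fxy z = fyx z" "fyy z = - fxx z"
      using mixed_partials_eq[OF f fx fy] lap[of z] by (auto simp: add_eq_0_iff)
    have "((\<lambda>z. fx z - \<i> * fy z) has_derivative (\<lambda>v. (Re v *\<^sub>R fxx z + Im v *\<^sub>R fxy z) -
       \<i> * (Re v *\<^sub>R fyx z + Im v *\<^sub>R fyy z))) (at z)"
      by (intro derivative_intros 1)
    then show ?thesis
      unfolding has_field_derivative_def
      by (rule has_derivative_eq_rhs)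
        (auto simp: fun_eq_iff e complex_eq_iff algebra_simps)
  qed
  then show ?thesis
    by (meson field_differentiable_at_within field_differentiable_def holomorphic_onI)
qed

text \<open>Comparing the two forms of the derivative in the directions 1 and \<open>\<i>\<close>
  gives \<open>fx z = deriv h z\<close> and \<open>fy z = \<i> * deriv h z\<close>.\<close>

lemma wirtinger_derivative_of_holomorphic:
  assumes f: "has_C1_partials_on f fx fy UNIV" and h: "h holomorphic_on S" and S: "open S"
    and eq: "\<And>z. z \<in> S \<Longrightarrow> f z = h z" and z: "z \<in> S"
  shows "fx z - \<i> * fy z = 2 * deriv h z"
proof -
  have "(h has_derivative (\<lambda>v. deriv h z * v)) (at z)"
    using h S z holomorphic_derivI by (auto simp flip: has_field_derivative_def)
  then have "(f has_derivative (\<lambda>v. deriv h z * v)) (at z)"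
    by (rule has_derivative_transform_within_open[OF _ S z]) (simp add: eq)
  moreover have "(f has_derivative (\<lambda>v. Re v *\<^sub>R fx z + Im v *\<^sub>R fy z)) (at z)"
    using f by (simp add: has_C1_partials_on_def)
  ultimately have *: "(\<lambda>v. deriv h z * v) = (\<lambda>v. Re v *\<^sub>R fx z + Im v *\<^sub>R fy z)"
    by (rule has_derivative_unique)
  have "fx z = deriv h z" "fy z = deriv h z * \<i>"
    using fun_cong[OF *, of 1] fun_cong[OF *, of \<i>] by auto
  then show ?thesis
    by (simp add: complex_eq_iff)
qed

section \<open>Taylor coefficients of harmonic functions and their uniqueness\<close>

lemma powser_coeff_eq_deriv:
  fixes h :: "complex \<Rightarrow> complex"
  assumes "0 < r" "\<And>z. z \<in> ball 0 r \<Longrightarrow> (\<lambda>k. a k * z ^ k) sums h z"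
  shows "a k = (deriv ^^ k) h 0 / fact k"
proof -
  have "h has_fps_expansion Abs_fps a"
    using assms eventually_nhds_in_open[of "ball 0 r" "0::complex"]
    by (intro has_fps_expansionI) (auto elim!: eventually_mono)
  from fps_nth_fps_expansion[OF this, of k] show ?thesis by simp
qed

text \<open>The extension \<open>F\<close> is only harmonic, but its Wirtinger derivative is entire
  and equals \<open>2 * deriv h\<close> on the disc. Hence the Taylor series of
  \<open>deriv h\<close> converges in the whole plane. This is the obstruction to harmonic extension
  used in part (b).\<close>

lemma harmonic_extension_of_holomorphic_coeffs:
  assumes F: "harmonic_entire_extension h F" and h: "h holomorphic_on ball 0 1"
    and a: "\<And>z. z \<in> ball 0 1 \<Longrightarrow> (\<lambda>k. a k * z ^ k) sums h z"
  shows "summable (\<lambda>k. of_nat (Suc k) * a (Suc k) * z ^ k)"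
proof -
  obtain fx fxx fxy fy fyx fyy where
    C: "has_C1_partials_on F fx fy UNIV" "has_C1_partials_on fx fxx fxy UNIV"
       "has_C1_partials_on fy fyx fyy UNIV" "\<And>z. fxx z + fyy z = 0"
    using F unfolding harmonic_entire_extension_def harmonic_on_def by auto
  define \<phi> where "\<phi> = (\<lambda>z. fx z - \<i> * fy z)"
  have hol: "\<phi> holomorphic_on UNIV"
    unfolding \<phi>_def by (rule harmonic_wirtinger_derivative_entire[OF C])
  have \<phi>: "\<phi> z = 2 * deriv h z" if "z \<in> ball 0 1" for z
    unfolding \<phi>_def using F that
    by (intro wirtinger_derivative_of_holomorphic[OF C(1) h]) (auto simp: harmonic_entire_extension_def)
  have co: "(deriv ^^ k) \<phi> 0 / fact k = 2 * of_nat (Suc k) * a (Suc k)" for k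
  proof -
    have "(deriv ^^ k) \<phi> 0 = (deriv ^^ k) (\<lambda>z. 2 * deriv h z) 0"
      using eventually_nhds_in_open[of "ball 0 1" "0::complex"]
      by (intro higher_deriv_cong_ev) (auto elim!: eventually_mono simp: \<phi>)
    also have "\<dots> = 2 * (deriv ^^ k) (deriv h) 0"
      by (rule higher_deriv_cmult[of _ "ball 0 1"]) (auto intro!: holomorphic_deriv h)
    also have "(deriv ^^ k) (deriv h) 0 = (deriv ^^ Suc k) h 0"
      by (simp add: funpow_swap1)
    also have "(deriv ^^ Suc k) h 0 = fact (Suc k) * a (Suc k)"
      using powser_coeff_eq_deriv[OF _ a, of 1 "Suc k"] by (simp add: field_simps del: fact_Suc)
    finally show ?thesis
      by (simp add: field_simps)
  qed
  have "\<phi> holomorphic_on ball 0 (norm z + 1)"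
    using hol holomorphic_on_subset by blast
  then have "summable (\<lambda>k. (deriv ^^ k) \<phi> 0 / fact k * (z - 0) ^ k)"
    by (intro sums_summable[OF holomorphic_power_series]) auto
  then have "summable (\<lambda>k. (1/2) * ((deriv ^^ k) \<phi> 0 / fact k * (z - 0) ^ k))"
    by (rule summable_mult)
  then show ?thesis
    unfolding co by (simp add: algebra_simps)
qed

text \<open>The difference of the two holomorphic parts is also the conjugate of a holomorphic
  function, hence constant, so all coefficients of positive index agree; the normalisation
  \<open>b 0 = 0\<close> settles index 0. Uniqueness transfers the coefficient bounds hidden under
  the existential quantifier of \<open>S_Hc\<close> to explicit coefficients.\<close>

lemma harmonic_expansion_unique:
  assumes 1: "harmonic_expansion f h g a b" and 2: "harmonic_expansion f h' g' a' b'"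
  shows "a = a'" "b = b'"
proof -
  define K L where "K = (\<lambda>z. h z - h' z)" and "L = (\<lambda>z. g' z - g z)"
  have hol: "K holomorphic_on ball 0 1" "L holomorphic_on ball 0 1"
    unfolding K_def L_def using 1 2 by (auto simp: harmonic_expansion_def intro!: holomorphic_intros)
  have KL: "K z = cnj (L z)" if "z \<in> ball 0 1" for z
  proof -
    have "h z + cnj (g z) = h' z + cnj (g' z)"
      using 1 2 that unfolding harmonic_expansion_def by metis
    then show ?thesis
      by (simp add: K_def L_def algebra_simps)
  qed
  have dK: "deriv K z = 0" and dL: "deriv L z = 0" if z: "z \<in> ball 0 1" for z
  proof -
    have "(K has_derivative (\<lambda>v. deriv K z * v)) (at z)"
      "(L has_derivative (\<lambda>v. deriv L z * v)) (at z)"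
      using hol z holomorphic_derivI by (auto simp flip: has_field_derivative_def)
    note this(1) has_derivative_cnj[OF this(2)]
    moreover have "((\<lambda>z. cnj (L z)) has_derivative (\<lambda>v. deriv K z * v)) (at z)"
      by (rule has_derivative_transform_within_open[OF calculation(1) _ z]) (auto simp: KL)
    \<comment> \<open>A map that is both complex-linear and conjugate-linear vanishes; the values at
      1 and \<open>\<i>\<close> show it.\<close>
    ultimately have *: "(\<lambda>v. deriv K z * v) = (\<lambda>v. cnj (deriv L z * v))"
      using has_derivative_unique by blast
    show "deriv K z = 0" "deriv L z = 0"
      using fun_cong[OF *, of 1] fun_cong[OF *, of \<i>] by auto
  qed
  have const: "u k = v k" if "p holomorphic_on ball 0 1" "q holomorphic_on ball 0 1"
    "\<And>z. z \<in> ball 0 1 \<Longrightarrow> deriv (\<lambda>z. p z - q z) z = 0"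
    "\<And>z. z \<in> ball 0 1 \<Longrightarrow> (\<lambda>k. u k * z ^ k) sums p z"
    "\<And>z. z \<in> ball 0 1 \<Longrightarrow> (\<lambda>k. v k * z ^ k) sums q z" "k \<noteq> 0" for p q u v k
  proof -
    have "(\<lambda>z. p z - q z) holomorphic_on ball 0 1"
      using that by (intro holomorphic_intros)
    then have "((\<lambda>z. p z - q z) has_field_derivative 0) (at z)" if "z \<in> ball 0 1" for z
      using that \<open>\<And>z. z \<in> ball 0 1 \<Longrightarrow> deriv (\<lambda>z. p z - q z) z = 0\<close>
      by (metis holomorphic_derivI open_ball)
    then obtain c where c: "\<And>z. z \<in> ball 0 1 \<Longrightarrow> p z - q z = c"
      using has_field_derivative_zero_constant[of "ball 0 1" "\<lambda>z. p z - q z"]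
        has_field_derivative_at_within by (metis (no_types, lifting) convex_ball)
    have "u k - v k = (deriv ^^ k) (\<lambda>z. p z - q z) 0 / fact k"
    proof (rule powser_coeff_eq_deriv[of 1 "\<lambda>k. u k - v k"])
      fix z :: complex assume "z \<in> ball 0 1"
      then show "(\<lambda>k. (u k - v k) * z ^ k) sums (p z - q z)"
        using sums_diff[OF that(4)[of z] that(5)[of z]] by (simp add: algebra_simps)
    qed auto
    also have "(deriv ^^ k) (\<lambda>z. p z - q z) 0 = (deriv ^^ k) (\<lambda>z. c) 0"
      using eventually_nhds_in_open[of "ball 0 1" "0::complex"]
      by (intro higher_deriv_cong_ev) (auto elim!: eventually_mono simp: c)
    also have "\<dots> = 0"
      using that(6) by (simp add: higher_deriv_const)
    finally show ?thesis by simp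
  qed
  have h: "h holomorphic_on ball 0 1" "h' holomorphic_on ball 0 1"
    "\<And>z. z \<in> ball 0 1 \<Longrightarrow> (\<lambda>k. a k * z ^ k) sums h z"
    "\<And>z. z \<in> ball 0 1 \<Longrightarrow> (\<lambda>k. a' k * z ^ k) sums h' z"
    and g: "g holomorphic_on ball 0 1" "g' holomorphic_on ball 0 1"
    "\<And>z. z \<in> ball 0 1 \<Longrightarrow> (\<lambda>k. b k * z ^ k) sums g z"
    "\<And>z. z \<in> ball 0 1 \<Longrightarrow> (\<lambda>k. b' k * z ^ k) sums g' z"
    using 1 2 unfolding harmonic_expansion_def by blast+
  have pos: "a k = a' k" "b' k = b k" if "k \<noteq> 0" for k
    using const[OF h(1,2) dK[unfolded K_def] h(3,4) that]
      const[OF g(2,1) dL[unfolded L_def] g(4,3) that] by simp_all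
  have at0: "p 0 = u 0" if "\<And>z. z \<in> ball 0 1 \<Longrightarrow> (\<lambda>k. u k * z ^ k) sums p z"
    for p :: "complex \<Rightarrow> complex" and u
    using that[of 0] powser_sums_zero_iff[of u "p 0"] by simp
  have b0: "b 0 = 0" "b' 0 = 0" using 1 2 by (auto simp: harmonic_expansion_def)
  have "h 0 = a 0" "h' 0 = a' 0" "g 0 = b 0" "g' 0 = b' 0"
    using at0[OF h(3)] at0[OF h(4)] at0[OF g(3)] at0[OF g(4)] by blast+
  with KL[of 0] b0 have "a 0 = a' 0"
    by (simp add: K_def L_def)
  then show "a = a'" "b = b'"
    using pos b0 by (metis ext)+
qed

section \<open>Coefficients and maximum modulus\<close>

lemma powser_higher_deriv:
  fixes h :: "complex \<Rightarrow> complex"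
  assumes h: "h holomorphic_on ball 0 1"
    and a: "\<And>z. z \<in> ball 0 1 \<Longrightarrow> (\<lambda>k. a k * z ^ k) sums h z"
    and z: "z \<in> ball 0 1"
  shows "(\<lambda>k. fact (n + k) / fact k * a (n + k) * z ^ k) sums (deriv ^^ n) h z"
proof -
  have "(deriv ^^ n) h holomorphic_on ball 0 1"
    using h by (intro holomorphic_higher_deriv) auto
  from holomorphic_power_series[OF this z]
  have "(\<lambda>k. (deriv ^^ k) ((deriv ^^ n) h) 0 / fact k * z ^ k) sums (deriv ^^ n) h z"
    by simp
  moreover have "(deriv ^^ k) ((deriv ^^ n) h) 0 = fact (n + k) * a (n + k)" for k
  proof -
    have "(deriv ^^ k) ((deriv ^^ n) h) 0 = (deriv ^^ (n + k)) h 0"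
      by (simp add: funpow_add[of k n deriv] add.commute[of n k])
    then show ?thesis
      using powser_coeff_eq_deriv[OF _ a, of 1 "n + k"] by simp
  qed
  ultimately show ?thesis by simp
qed

lemma powser_drop_constant_term:
  fixes z :: complex
  assumes "(\<lambda>k. t k * z ^ k) sums s"
  shows "(\<lambda>k. (if k = 0 then 0 else t k / c) * z ^ k) sums ((s - t 0) / c)"
proof -
  have "(\<lambda>k. if k = 0 then t 0 * z ^ k else 0) sums (t 0 * z ^ 0)"
    by (rule sums_single)
  from sums_divide[OF sums_diff[OF assms this], of c]
  have "(\<lambda>k. (t k * z ^ k - (if k = 0 then t 0 * z ^ k else 0)) / c) sums ((s - t 0) / c)"
    by simp
  moreover have "(\<lambda>k. (t k * z ^ k - (if k = 0 then t 0 * z ^ k else 0)) / c) =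
      (\<lambda>k. (if k = 0 then 0 else t k / c) * z ^ k)"
    by auto
  ultimately show ?thesis
    by metis
qed

text \<open>Taylor coefficients of the \<open>n\<close>-th derivative of the series with
  coefficients \<open>a\<close>, after its constant term is removed and the rest is divided by
  \<open>c\<close>.\<close>

definition quotient_coeff :: "nat \<Rightarrow> (nat \<Rightarrow> complex) \<Rightarrow> complex \<Rightarrow> nat \<Rightarrow> complex" where
  "quotient_coeff n a c k = (if k = 0 then 0 else fact (n + k) / fact k * a (n + k) / c)"

text \<open>The divisor of the co-analytic part is \<open>cnj c\<close>, because that part enters
  conjugated.\<close>

lemma harmonic_expansion_quotient:
  assumes h: "h holomorphic_on ball 0 1" "\<And>z. z \<in> ball 0 1 \<Longrightarrow> (\<lambda>k. a k * z ^ k) sums h z"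
    and g: "g holomorphic_on ball 0 1" "\<And>z. z \<in> ball 0 1 \<Longrightarrow> (\<lambda>k. b k * z ^ k) sums g z"
  shows "harmonic_expansion
     (\<lambda>z. (harmonic_deriv n h g z - fact n * a n - fact n * cnj (b n)) / c)
     (\<lambda>z. ((deriv ^^ n) h z - fact n * a n) / c) (\<lambda>z. ((deriv ^^ n) g z - fact n * b n) / cnj c)
     (quotient_coeff n a c) (quotient_coeff n b (cnj c))"
proof -
  have "(\<lambda>z. ((deriv ^^ n) h z - fact n * a n) / c) holomorphic_on ball 0 1"
    if "h holomorphic_on ball 0 1" for h a c
    unfolding divide_inverse by (intro holomorphic_intros holomorphic_higher_deriv that open_ball)
  moreover have "(\<lambda>k. quotient_coeff n a c k * z ^ k) sums (((deriv ^^ n) h z - fact n * a n) / c)"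
    if "h holomorphic_on ball 0 1" "\<And>z. z \<in> ball 0 1 \<Longrightarrow> (\<lambda>k. a k * z ^ k) sums h z" "z \<in> ball 0 1"
    for h a c z
    using powser_drop_constant_term[OF powser_higher_deriv[OF that, of n], of c]
    by (simp add: quotient_coeff_def[abs_def])
  ultimately show ?thesis
    using h g unfolding harmonic_expansion_def
    by (auto simp: harmonic_deriv_def quotient_coeff_def diff_divide_distrib add_divide_distrib)
qed

text \<open>By uniqueness the bound of \<open>S_Hc\<close> holds for \<open>quotient_coeff\<close>,
  and (2 k^2 + 1) / 3 is at most k^2 for k at least 2; clearing denominators gives the factorial
  form. The case \<open>k = 1\<close> rests on \<open>ba\<close>.\<close>

lemma S_Hc_quotient_coeff_bound:
  assumes h: "h holomorphic_on ball 0 1" "\<And>z. z \<in> ball 0 1 \<Longrightarrow> (\<lambda>k. a k * z ^ k) sums h z"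
    and g: "g holomorphic_on ball 0 1" "\<And>z. z \<in> ball 0 1 \<Longrightarrow> (\<lambda>k. b k * z ^ k) sums g z"
    and Q: "(\<lambda>z. (harmonic_deriv n h g z - fact n * a n - fact n * cnj (b n))
                 / (fact (n + 1) * a (n + 1))) \<in> S_Hc"
    and ba: "norm (b (n + 1)) \<le> norm (a (n + 1))" and k: "k \<ge> 1"
  shows "a (n + 1) \<noteq> 0"
    and "fact (n + k) * norm (a (n + k)) \<le> real k ^ 2 * fact k * (fact (n + 1) * norm (a (n + 1)))"
    and "fact (n + k) * norm (b (n + k)) \<le> real k ^ 2 * fact k * (fact (n + 1) * norm (a (n + 1)))"
proof -
  define c where "c = fact (n + 1) * a (n + 1)"
  show a: "a (n + 1) \<noteq> 0"
  proof
    assume "a (n + 1) = 0"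
    \<comment> \<open>Division by zero turns the quotient into the zero function, which is not
      injective.\<close>
    then have "(\<lambda>z. 0) \<in> S_Hc" using Q by simp
    then have "inj_on (\<lambda>z::complex. 0::complex) (ball 0 1)"
      unfolding S_Hc_def S_H_def mem_Collect_eq by blast
    then have "(0::complex) = 1/2"
      by (rule inj_onD) auto
    then show False by simp
  qed
  then have c: "c \<noteq> 0" by (simp add: c_def del: fact_Suc)
  have nc: "norm c = fact (n + 1) * norm (a (n + 1))"
    by (simp add: c_def norm_mult del: fact_Suc)
  obtain H G A B where HG: "harmonic_expansion (\<lambda>z. (harmonic_deriv n h g z - fact n * a n - fact n * cnj (b n)) / c) H G A B"
    and AB: "\<And>k. k \<ge> 2 \<Longrightarrow> norm (A k) < (2 * real k ^ 2 + 1) / 3 \<and> norm (B k) < (2 * real k ^ 2 + 1) / 3"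
    using Q unfolding S_Hc_def c_def by blast
  have eq: "A = quotient_coeff n a c" "B = quotient_coeff n b (cnj c)"
    using harmonic_expansion_unique[OF HG harmonic_expansion_quotient[OF h g]] by auto
  \<comment> \<open>One estimate for both sequences: \<open>c'\<close> will be \<open>c\<close> for
    \<open>a\<close> and \<open>cnj c\<close> for \<open>b\<close>.\<close>
  have *: "fact (n + k) * norm (u (n + k)) \<le> real k ^ 2 * fact k * norm c"
    if u: "norm (u (n + 1)) \<le> norm (a (n + 1))"
      "k \<ge> 2 \<Longrightarrow> norm (quotient_coeff n u c' k) < (2 * real k ^ 2 + 1) / 3" "norm c' = norm c"
    for u c'
  proof (cases "k = 1")
    case True
    then show ?thesis using u by (simp add: nc del: fact_Suc)
  next
    case False
    with k have k2: "k \<ge> 2" by simp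
    then have "(2 * real k ^ 2 + 1) / 3 \<le> real k ^ 2" by simp
    with u(2)[OF k2] have "norm (quotient_coeff n u c' k) \<le> real k ^ 2"
      by (rule less_imp_le[OF less_le_trans])
    moreover have "norm (quotient_coeff n u c' k) = fact (n + k) / fact k * norm (u (n + k)) / norm c"
      using k2 u(3) by (simp add: quotient_coeff_def norm_mult norm_divide)
    ultimately show ?thesis
      using c by (simp add: field_simps)
  qed
  show "fact (n + k) * norm (a (n + k)) \<le> real k ^ 2 * fact k * (fact (n + 1) * norm (a (n + 1)))"
    using *[of a c] AB[of k] by (simp add: eq nc)
  show "fact (n + k) * norm (b (n + k)) \<le> real k ^ 2 * fact k * (fact (n + 1) * norm (a (n + 1)))"
    using *[of b "cnj c"] AB[of k] ba by (simp add: eq nc)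
qed

text \<open>The second normalised quotient is the first one with \<open>h\<close> and
  \<open>g\<close> exchanged, so the previous lemma covers both cases, and the maximum of the two
  moduli removes the case distinction.\<close>

lemma admissible_pair_coeff_bound:
  assumes "admissible_pair f n"
  obtains h g a b where "harmonic_expansion f h g a b"
    "\<And>p. max (norm (a (n p + 1))) (norm (b (n p + 1))) > 0"
    "\<And>p k. k \<ge> 1 \<Longrightarrow> fact (n p + k) * max (norm (a (n p + k))) (norm (b (n p + k))) \<le>
        real k ^ 2 * fact k * (fact (n p + 1) * max (norm (a (n p + 1))) (norm (b (n p + 1))))"
proof -
  obtain h g a b where E: "harmonic_expansion f h g a b" and
    1: "\<And>p. norm (b (n p + 1)) \<le> norm (a (n p + 1)) \<Longrightarrow>
            (\<lambda>z. (harmonic_deriv (n p) h g z - fact (n p) * a (n p) - fact (n p) * cnj (b (n p)))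
                 / (fact (n p + 1) * a (n p + 1))) \<in> S_Hc" and
    2: "\<And>p. norm (a (n p + 1)) \<le> norm (b (n p + 1)) \<Longrightarrow>
            (\<lambda>z. (cnj (harmonic_deriv (n p) h g z) - fact (n p) * cnj (a (n p)) - fact (n p) * b (n p))
                 / (fact (n p + 1) * b (n p + 1))) \<in> S_Hc"
    using assms unfolding admissible_pair_def by blast
  have h: "h holomorphic_on ball 0 1" "\<And>z. z \<in> ball 0 1 \<Longrightarrow> (\<lambda>k. a k * z ^ k) sums h z"
    and g: "g holomorphic_on ball 0 1" "\<And>z. z \<in> ball 0 1 \<Longrightarrow> (\<lambda>k. b k * z ^ k) sums g z"
    using E unfolding harmonic_expansion_def by blast+
  have swap: "(\<lambda>z. (harmonic_deriv (n p) g h z - fact (n p) * b (n p) - fact (n p) * cnj (a (n p)))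
                 / (fact (n p + 1) * b (n p + 1))) \<in> S_Hc"
    if "norm (a (n p + 1)) \<le> norm (b (n p + 1))" for p
    using 2[OF that] by (simp add: harmonic_deriv_def algebra_simps)
  have "max (norm (a (n p + 1))) (norm (b (n p + 1))) > 0 \<and>
      fact (n p + k) * max (norm (a (n p + k))) (norm (b (n p + k))) \<le>
        real k ^ 2 * fact k * (fact (n p + 1) * max (norm (a (n p + 1))) (norm (b (n p + 1))))"
    if k: "k \<ge> 1" for p k
  proof (cases "norm (b (n p + 1)) \<le> norm (a (n p + 1))")
    case True
    then show ?thesis
      using S_Hc_quotient_coeff_bound[OF h g 1[OF True] True k]
      by (auto simp: max_def)
  next
    case False
    then have False: "norm (a (n p + 1)) \<le> norm (b (n p + 1))" by simp
    then show ?thesis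
      using S_Hc_quotient_coeff_bound[OF g h swap[OF False] False k]
      by (auto simp: max_def)
  qed
  from this[of 1] this show ?thesis
    by (intro that[OF E]) blast+
qed

section \<open>Harmonic entire mappings given by power series, and their maximum modulus\<close>

lemma powser_entire:
  fixes a :: "nat \<Rightarrow> complex"
  assumes "\<And>z. summable (\<lambda>k. a k * z ^ k)"
  shows "(\<lambda>z. \<Sum>k. a k * z ^ k) holomorphic_on UNIV"
proof -
  have "(\<lambda>z. \<Sum>k. a k * z ^ k) holomorphic_on ball 0 r" for r
    using power_series_holomorphic[of 0 r a "\<lambda>z. \<Sum>k. a k * z ^ k"] assms by (simp add: summable_sums)
  then have "(\<lambda>z. \<Sum>k. a k * z ^ k) field_differentiable at z" for z
    by (rule holomorphic_on_imp_differentiable_at[of _ "ball 0 (norm z + 1)"]) auto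
  then show ?thesis
    by (simp add: holomorphic_on_def)
qed

lemma harmonic_entire_extension_powser:
  assumes "harmonic_expansion f h g a b"
    and "\<And>z. summable (\<lambda>k. a k * z ^ k)" "\<And>z. summable (\<lambda>k. b k * z ^ k)"
  shows "harmonic_entire_extension f (\<lambda>z. (\<Sum>k. a k * z ^ k) + cnj (\<Sum>k. b k * z ^ k))"
  unfolding harmonic_entire_extension_def
proof
  show "harmonic_on (\<lambda>z. (\<Sum>k. a k * z ^ k) + cnj (\<Sum>k. b k * z ^ k)) UNIV"
    by (intro harmonic_on_holomorphic_plus_cnj powser_entire assms) auto
  show "\<forall>z\<in>ball 0 1. (\<Sum>k. a k * z ^ k) + cnj (\<Sum>k. b k * z ^ k) = f z"
    using assms(1) unfolding harmonic_expansion_def by (auto simp: sums_iff)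
qed

lemma max_modulus_ge:
  assumes "continuous_on UNIV F" "z \<in> sphere 0 r"
  shows "norm (F z) \<le> max_modulus r F"
proof -
  have "compact ((\<lambda>z. norm (F z)) ` sphere 0 r)"
    using assms(1) by (intro compact_continuous_image continuous_intros) (auto intro: continuous_on_subset)
  then show ?thesis
    unfolding max_modulus_def using assms(2)
    by (intro cSUP_upper bounded_imp_bdd_above compact_imp_bounded)
qed

lemma max_modulus_le:
  assumes "0 \<le> r" "\<And>z. z \<in> sphere 0 r \<Longrightarrow> norm (F z) \<le> B"
  shows "max_modulus r F \<le> B"
proof -
  have "complex_of_real r \<in> sphere 0 r" using assms by simp
  then show ?thesis
    unfolding max_modulus_def using assms by (intro cSUP_least) auto
qed

text \<open>The maximum principle for the real part spreads a bound on arbitrarily large circles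
  over the plane; then exp of \<open>f\<close> is bounded, so constant by Liouville, and
  \<open>f\<close> has derivative 0 because exp never vanishes.\<close>

lemma entire_constant_if_Re_bounded_on_circles:
  assumes f: "f holomorphic_on UNIV"
    and fr: "\<exists>\<^sub>F r in at_top. \<forall>z\<in>sphere (0::complex) r. Re (f z) \<le> K"
  shows "f constant_on UNIV"
proof -
  have bd: "Re (f z) \<le> K" for z
  proof -
    obtain r where r: "r > norm z" "\<forall>z\<in>sphere (0::complex) r. Re (f z) \<le> K"
      using frequently_eventually_conj[OF fr eventually_gt_at_top[of "norm z"]] frequently_ex by blast
    have "f holomorphic_on cball 0 r" "f holomorphic_on ball 0 r"
      using f holomorphic_on_subset by blast+
    then show ?thesis
      using r by (intro maximum_real_frontier[of f "cball 0 r" K z])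
        (auto intro!: holomorphic_on_imp_continuous_on)
  qed
  have "norm (exp (f z)) \<le> exp K" for z
    using bd[of z] by (simp add: norm_exp_eq_Re)
  then have "(\<lambda>z. exp (f z)) constant_on UNIV"
    by (intro Liouville_theorem holomorphic_intros f) (auto simp: bounded_iff)
  then obtain c where c: "\<And>z. exp (f z) = c"
    by (auto simp: constant_on_def)
  have "(f has_field_derivative 0) (at z within UNIV)" for z
  proof -
    have 1: "(f has_field_derivative deriv f z) (at z)"
      using f by (simp add: holomorphic_derivI)
    have "((\<lambda>z. exp (f z)) has_field_derivative exp (f z) * deriv f z) (at z)"
      using DERIV_chain2[OF DERIV_exp 1] .
    moreover have "((\<lambda>z. exp (f z)) has_field_derivative 0) (at z)"
      unfolding c by simp
    ultimately have "deriv f z = 0"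
      using DERIV_unique by fastforce
    with 1 show ?thesis by simp
  qed
  then show ?thesis
    using has_field_derivative_zero_constant[of UNIV f] by (auto simp: constant_on_def)
qed

text \<open>
  Since \<^term>\<open>ln\<close> on the reals is \<open>ln |x|\<close>, iterated logarithms of the maximum modulus are
  meaningful only once it is known to exceed 1.
\<close>

lemma max_modulus_tendsto_infinity:
  assumes h: "h holomorphic_on UNIV" and g: "g holomorphic_on UNIV"
    and nc: "\<not> (h constant_on UNIV \<and> g constant_on UNIV)"
  shows "filterlim (\<lambda>r. max_modulus r (\<lambda>z. h z + cnj (g z))) at_top at_top"
proof (rule ccontr)
  let ?F = "\<lambda>z. h z + cnj (g z)"
  assume "\<not> ?thesis"
  then obtain K where K: "\<exists>\<^sub>F r in at_top. max_modulus r ?F < K"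
    unfolding filterlim_at_top by (auto simp: not_eventually not_le)
  have cont: "continuous_on UNIV ?F"
    by (intro continuous_intros holomorphic_on_imp_continuous_on h g)
  have F: "\<exists>\<^sub>F r in at_top. \<forall>z\<in>sphere (0::complex) r. norm (?F z) \<le> K"
    using K
  proof (rule frequently_elim1, intro ballI)
    fix r and z :: complex assume "max_modulus r ?F < K" "z \<in> sphere 0 r"
    then show "norm (?F z) \<le> K"
      using max_modulus_ge[OF cont, of z r] by linarith
  qed
  \<comment> \<open>The real part of \<open>?F\<close> is that of the entire function h + g, and its
    imaginary part is the real part of \<open>- \<i> * (h z - g z)\<close>. Both combinations are
    therefore constant, and they determine \<open>h\<close> and \<open>g\<close>.\<close>
  have "(\<lambda>z. h z + g z) constant_on UNIV"
  proof (rule entire_constant_if_Re_bounded_on_circles)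
    show "\<exists>\<^sub>F r in at_top. \<forall>z\<in>sphere (0::complex) r. Re (h z + g z) \<le> K"
      using F
    proof (rule frequently_elim1, intro ballI)
      fix r and z :: complex assume "\<forall>z\<in>sphere (0::complex) r. norm (?F z) \<le> K" "z \<in> sphere 0 r"
      then have "norm (?F z) \<le> K" by blast
      then show "Re (h z + g z) \<le> K"
        using complex_Re_le_cmod[of "?F z"] by simp
    qed
  qed (intro holomorphic_intros h g)
  then obtain c where c: "\<And>z. h z + g z = c" by (auto simp: constant_on_def)
  have "(\<lambda>z. - \<i> * (h z - g z)) constant_on UNIV"
  proof (rule entire_constant_if_Re_bounded_on_circles)
    show "\<exists>\<^sub>F r in at_top. \<forall>z\<in>sphere (0::complex) r. Re (- \<i> * (h z - g z)) \<le> K"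
      using F
    proof (rule frequently_elim1, intro ballI)
      fix r and z :: complex assume "\<forall>z\<in>sphere (0::complex) r. norm (?F z) \<le> K" "z \<in> sphere 0 r"
      then have "norm (?F z) \<le> K" by blast
      then show "Re (- \<i> * (h z - g z)) \<le> K"
        using abs_Im_le_cmod[of "?F z"] by simp
    qed
  qed (intro holomorphic_intros h g)
  then obtain d where d: "\<And>z. - \<i> * (h z - g z) = d" by (auto simp: constant_on_def)
  have "h z = (c + \<i> * d) / 2 \<and> g z = (c - \<i> * d) / 2" for z
    using c[of z] d[of z] by (auto simp: complex_eq_iff)
  then have "h constant_on UNIV \<and> g constant_on UNIV"
    unfolding constant_on_def by blast
  with nc show False by blast
qed

lemma powser_not_constant:
  fixes a :: "nat \<Rightarrow> complex"
  assumes "\<And>z. summable (\<lambda>k. a k * z ^ k)" "j > 0" "a j \<noteq> 0"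
  shows "\<not> (\<lambda>z. \<Sum>k. a k * z ^ k) constant_on UNIV"
proof
  assume "(\<lambda>z. \<Sum>k. a k * z ^ k) constant_on UNIV"
  then obtain c where c: "\<And>z. (\<Sum>k. a k * z ^ k) = c" by (auto simp: constant_on_def)
  have "a j = (deriv ^^ j) (\<lambda>z. c) 0 / fact j"
  proof (rule powser_coeff_eq_deriv[of 1])
    fix z :: complex
    show "(\<lambda>k. a k * z ^ k) sums c"
      using summable_sums[OF assms(1)[of z]] c by simp
  qed simp
  with assms(2,3) show False by (simp add: higher_deriv_const)
qed

section \<open>Order of growth\<close>

lemma growth_order_le:
  assumes lim: "filterlim (\<lambda>r. max_modulus r F) at_top at_top"
    and ev: "eventually (\<lambda>r. max_modulus r F \<le> exp (r powr s)) at_top"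
  shows "growth_order F \<le> ereal s"
  unfolding growth_order_def
proof (rule Limsup_bounded)
  have "eventually (\<lambda>r. max_modulus r F > 1) at_top"
    using lim by (simp add: filterlim_at_top_dense)
  with ev eventually_gt_at_top[of 1]
  show "\<forall>\<^sub>F r in at_top. ereal (ln (ln (max_modulus r F)) / ln r) \<le> ereal s"
  proof eventually_elim
    case (elim r)
    have "0 < ln (max_modulus r F)"
      using elim by simp
    moreover have "ln (max_modulus r F) \<le> r powr s"
      using elim by (metis exp_gt_zero less_trans ln_exp ln_le_cancel_iff zero_less_one)
    ultimately have "ln (ln (max_modulus r F)) \<le> ln (r powr s)"
      using elim by (subst ln_le_cancel_iff) auto
    with elim show ?case
      by (simp add: ln_powr divide_le_eq)
  qed
qed

text \<open>The order is an upper limit, so a lower bound along one sequence of radii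
  suffices.\<close>

lemma growth_order_ge:
  assumes R: "filterlim R at_top sequentially"
    and x: "eventually (\<lambda>k. 0 < x k \<and> x k \<le> ln (max_modulus (R k) F)) sequentially"
    and L: "(\<lambda>k. ereal (ln (x k) / ln (R k))) \<longlonglongrightarrow> L"
  shows "L \<le> growth_order F"
proof (rule ccontr)
  assume "\<not> ?thesis"
  then obtain y where y: "growth_order F < y" "y < L"
    using dense by (auto simp: not_le)
  from L y(2) have "eventually (\<lambda>k. y < ereal (ln (x k) / ln (R k))) sequentially"
    by (rule order_tendstoD)
  with x eventually_compose_filterlim[OF eventually_gt_at_top[of 1] R]
  have *: "eventually (\<lambda>k. y < ereal (ln (ln (max_modulus (R k) F)) / ln (R k))) sequentially"
  proof eventually_elim
    case (elim k)
    then have "ln (x k) / ln (R k) \<le> ln (ln (max_modulus (R k) F)) / ln (R k)"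
      by (intro divide_right_mono) auto
    with elim show ?case
      by (meson ereal_less_eq(3) less_le_trans)
  qed
  have "eventually (\<lambda>r. ereal (ln (ln (max_modulus r F)) / ln r) < y) at_top"
    using y(1) unfolding growth_order_def by (rule Limsup_lessD)
  from eventually_compose_filterlim[OF this R] *
  have "eventually (\<lambda>k. False) sequentially"
    by eventually_elim auto
  then show False by simp
qed

text \<open>
  The terms of index \<open>j \<ge> (2 E r)\<^bsup>1/\<gamma>\<^esup>\<close> are dominated by a geometric series; there are at most
  \<open>(2 E r)\<^bsup>1/\<gamma>\<^esup> + 1\<close> other ones.
\<close>

lemma powser_growth_bound:
  fixes a :: "nat \<Rightarrow> complex"
  assumes a: "\<And>j. norm (a j) \<le> C * (E / real j powr \<gamma>) ^ j"
    and E: "E \<ge> 1" and C: "C \<ge> 0" and \<gamma>: "\<gamma> > 0" and z: "norm z = r" "r \<ge> 1"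
  defines "X \<equiv> (2 * E * r) powr (1 / \<gamma>)"
  shows "summable (\<lambda>k. a k * z ^ k)"
    and "norm (\<Sum>k. a k * z ^ k) \<le> C * ((X + 1) * (E * r) powr (X + 1) + 2)"
proof -
  define N where "N = nat \<lceil>X\<rceil>"
  have Er: "E * r \<ge> 1" using E z mult_mono[of 1 E 1 r] by simp
  have X0: "X \<ge> 0" by (simp add: X_def)
  then have N: "real N \<le> X + 1" "X \<le> real N" by (auto simp: N_def; linarith)+
  \<comment> \<open>The geometric part is added for all \<open>j\<close> so that \<open>t\<close> is
    a sum of two summable sequences. The bound for \<open>j < N\<close> includes
    \<open>j = 0\<close>, where the power with exponent 0 is 1.\<close>
  define t where "t = (\<lambda>j. (if j \<in> {..<N} then C * (E * r) powr (X + 1) else 0) + C * (1/2) ^ j)"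
  have bd: "norm (a j * z ^ j) \<le> t j" for j
  proof -
    have "norm (a j * z ^ j) \<le> C * (E / real j powr \<gamma>) ^ j * r ^ j"
      unfolding norm_mult norm_power z by (intro mult_right_mono a) (use z in auto)
    also have "\<dots> = C * (E * r / real j powr \<gamma>) ^ j"
      by (simp add: power_mult_distrib power_divide)
    also have "\<dots> \<le> t j"
    proof (cases "j < N")
      case True
      have "(E * r / real j powr \<gamma>) ^ j \<le> (E * r) ^ j"
      proof (cases "j = 0")
        case False
        then have "real j powr \<gamma> \<ge> 1" using \<gamma> by (intro ge_one_powr_ge_zero) auto
        then have "E * r / real j powr \<gamma> \<le> E * r"
          using Er False divide_left_mono[of 1 "real j powr \<gamma>" "E * r"] by simp
        then show ?thesis
          using Er by (intro power_mono) auto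
      qed simp
      also have "\<dots> = (E * r) powr real j" using Er by (simp add: powr_realpow)
      also have "\<dots> \<le> (E * r) powr (X + 1)"
        using Er True N by (intro powr_mono) auto
      finally have "C * (E * r / real j powr \<gamma>) ^ j \<le> C * (E * r) powr (X + 1)"
        using C by (rule mult_left_mono)
      moreover have "0 \<le> C * (1/2) ^ j" using C by simp
      ultimately show ?thesis unfolding t_def using True by simp
    next
      case False
      then have "X \<le> real j" using N by linarith
      then have "X powr \<gamma> \<le> real j powr \<gamma>"
        using X0 \<gamma> by (intro powr_mono2) auto
      then have "2 * E * r \<le> real j powr \<gamma>"
        using \<gamma> Er by (simp add: X_def powr_powr)
      then have "E * r / real j powr \<gamma> \<le> 1 / 2"
        using Er by (simp add: divide_le_eq)
      then have "(E * r / real j powr \<gamma>) ^ j \<le> (1 / 2) ^ j"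
        using Er by (intro power_mono) auto
      then show ?thesis
        using False C by (simp add: t_def mult_left_mono)
    qed
    finally show ?thesis .
  qed
  have "(\<lambda>j. C * (1/2::real) ^ j) sums (C * (1 / (1 - 1/2)))"
    by (intro sums_mult geometric_sums) simp
  moreover have "(\<lambda>j. if j \<in> {..<N} then C * (E * r) powr (X + 1) else 0)
      sums (\<Sum>j<N. C * (E * r) powr (X + 1))"
    by (rule sums_If_finite_set) simp
  ultimately have t: "t sums ((\<Sum>j<N. C * (E * r) powr (X + 1)) + C * (1 / (1 - 1/2)))"
    unfolding t_def by (intro sums_add)
  show "summable (\<lambda>k. a k * z ^ k)"
    using bd by (intro summable_comparison_test'[OF sums_summable[OF t]])
  have "norm (\<Sum>k. a k * z ^ k) \<le> suminf t"
    using bd by (intro norm_suminf_le sums_summable[OF t])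
  also have "suminf t = real N * (C * (E * r) powr (X + 1)) + C * 2"
    using sums_unique[OF t] by simp
  also have "\<dots> \<le> (X + 1) * (C * (E * r) powr (X + 1)) + C * 2"
    using N C by (intro add_right_mono mult_right_mono) auto
  finally show "norm (\<Sum>k. a k * z ^ k) \<le> C * ((X + 1) * (E * r) powr (X + 1) + 2)"
    by (simp add: algebra_simps)
qed

text \<open>The finitely many early indices are absorbed into the constant by adding all their
  ratios \<open>\<bar>m j\<bar> / w j\<close>.\<close>

lemma eventually_coeff_bound_imp_all:
  fixes m w :: "nat \<Rightarrow> real"
  assumes "\<And>j. j \<ge> J \<Longrightarrow> m j \<le> C * w j" "\<And>j. w j > 0"
  obtains D where "D \<ge> 0" "\<And>j. m j \<le> D * w j"
proof
  define D where "D = \<bar>C\<bar> + (\<Sum>j<J. \<bar>m j\<bar> / w j)"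
  have nn: "0 \<le> (\<Sum>j<J. \<bar>m j\<bar> / w j)" using assms(2) by (intro sum_nonneg) (simp add: less_imp_le)
  then show "D \<ge> 0" by (simp add: D_def)
  fix j
  show "m j \<le> D * w j"
  proof (cases "j < J")
    case True
    have "m j \<le> \<bar>m j\<bar> / w j * w j" using assms(2)[of j] by simp
    also have "\<bar>m j\<bar> / w j \<le> (\<Sum>j<J. \<bar>m j\<bar> / w j)"
      using True assms(2) by (intro member_le_sum) (auto simp: less_imp_le)
    also have "\<dots> \<le> D"
      by (simp add: D_def)
    finally show ?thesis
      using assms(2)[of j] by simp
  next
    case False
    then have "m j \<le> C * w j" using assms by simp
    also have "\<dots> \<le> D * w j"
      using nn assms(2)[of j] by (intro mult_right_mono) (auto simp: D_def)
    finally show ?thesis .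
  qed
qed

text \<open>The logarithm of the left side grows at most like r^(1/\<gamma>) ln r, which is below
  r^s. The factor 2 accounts for the analytic and the co-analytic part.\<close>

lemma growth_bound_asymp:
  fixes C E \<gamma> s :: real
  assumes "C \<ge> 0" "E \<ge> 1" "\<gamma> > 0" "1 / \<gamma> < s"
  shows "eventually (\<lambda>r. 2 * (C * (((2 * E * r) powr (1 / \<gamma>) + 1) *
     (E * r) powr ((2 * E * r) powr (1 / \<gamma>) + 1) + 2)) \<le> exp (r powr s)) at_top"
proof -
  define u where "u = 1 / \<gamma>"
  have u: "0 < u" "u < s" using assms by (auto simp: u_def)
  have "eventually (\<lambda>r. 2 * (C * (((2 * E * r) powr u + 1) *
     (E * r) powr ((2 * E * r) powr u + 1) + 2)) \<le> exp (r powr s)) at_top"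
  proof (cases "C = 0")
    case False
    then have "C > 0" "E > 0" using assms by auto
    with u show ?thesis by real_asymp
  qed auto
  then show ?thesis by (simp add: u_def)
qed

text \<open>The previous estimates bound the order by every real s above
  \<open>1 / \<gamma>\<close>. A nonzero coefficient of positive index makes the maximum modulus
  tend to infinity, as \<open>growth_order_le\<close> demands.\<close>

lemma growth_order_powser_le:
  fixes a b :: "nat \<Rightarrow> complex"
  assumes a: "\<And>j. j \<ge> J \<Longrightarrow> norm (a j) \<le> C * (E / real j powr \<gamma>) ^ j"
    and b: "\<And>j. j \<ge> J \<Longrightarrow> norm (b j) \<le> C * (E / real j powr \<gamma>) ^ j"
    and E: "E \<ge> 1" and \<gamma>: "\<gamma> > 0"
  shows "summable (\<lambda>k. a k * z ^ k)" "summable (\<lambda>k. b k * z ^ k)"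
    and "j > 0 \<Longrightarrow> a j \<noteq> 0 \<or> b j \<noteq> 0 \<Longrightarrow>
      growth_order (\<lambda>z. (\<Sum>k. a k * z ^ k) + cnj (\<Sum>k. b k * z ^ k)) \<le> ereal (1 / \<gamma>)"
proof -
  let ?F = "\<lambda>z. (\<Sum>k. a k * z ^ k) + cnj (\<Sum>k. b k * z ^ k)"
  \<comment> \<open>The weight at 0 is the default value of the formula, since
    \<open>(E / 0) ^ 0 = 1\<close>; thus \<open>w\<close> is positive everywhere.\<close>
  define w where "w = (\<lambda>j. if j = 0 then 1 else (E / real j powr \<gamma>) ^ j)"
  have weq: "w j = (E / real j powr \<gamma>) ^ j" for j by (simp add: w_def)
  have w: "w j > 0" for j using E by (simp add: w_def)
  obtain D1 where D1: "D1 \<ge> 0" "\<And>j. norm (a j) \<le> D1 * w j"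
    using eventually_coeff_bound_imp_all[of J "\<lambda>j. norm (a j)" C w] a w by (auto simp: weq)
  obtain D2 where D2: "D2 \<ge> 0" "\<And>j. norm (b j) \<le> D2 * w j"
    using eventually_coeff_bound_imp_all[of J "\<lambda>j. norm (b j)" C w] b w by (auto simp: weq)
  define D where "D = max D1 D2"
  have D: "D \<ge> 0" and ab: "norm (a j) \<le> D * (E / real j powr \<gamma>) ^ j"
      "norm (b j) \<le> D * (E / real j powr \<gamma>) ^ j" for j
    unfolding weq[symmetric]
    using D1(1) order_trans[OF D1(2)[of j] mult_right_mono[of D1 D "w j"]]
      order_trans[OF D2(2)[of j] mult_right_mono[of D2 D "w j"]] w[of j]
    by (auto simp: D_def)
  note A = powser_growth_bound[OF ab(1) E D \<gamma>] and B = powser_growth_bound[OF ab(2) E D \<gamma>]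
  \<comment> \<open>The growth bound speaks of \<open>norm z \<ge> 1\<close> only; convergence at 1
    covers the points inside the disc.\<close>
  have all: "summable (\<lambda>k. u k * z ^ k)" if "\<And>z. norm z \<ge> 1 \<Longrightarrow> summable (\<lambda>k. u k * z ^ k)"
    for u :: "nat \<Rightarrow> complex" and z
  proof (cases "norm z < 1")
    case True
    with that[of 1] show ?thesis
      by (intro powser_inside[of u 1 z]) auto
  qed (simp add: that)
  show sa: "summable (\<lambda>k. a k * z ^ k)" for z
    by (rule all) (use A(1) in blast)
  show sb: "summable (\<lambda>k. b k * z ^ k)" for z
    by (rule all) (use B(1) in blast)
  assume j: "j > 0" "a j \<noteq> 0 \<or> b j \<noteq> 0"
  have lim: "filterlim (\<lambda>r. max_modulus r ?F) at_top at_top"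
    using powser_not_constant[OF sa j(1)] powser_not_constant[OF sb j(1)] j(2)
    by (intro max_modulus_tendsto_infinity powser_entire sa sb) auto
  show "growth_order ?F \<le> ereal (1 / \<gamma>)"
  proof (rule dense_ge)
    fix s assume s: "ereal (1 / \<gamma>) < s"
    then show "growth_order ?F \<le> s"
    proof (cases s)
      case (real s')
      let ?X = "\<lambda>r. (2 * E * r) powr (1 / \<gamma>)"
      have "eventually (\<lambda>r. 2 * (D * ((?X r + 1) * (E * r) powr (?X r + 1) + 2)) \<le> exp (r powr s')) at_top"
        using s real by (intro growth_bound_asymp D E \<gamma>) auto
      with eventually_ge_at_top[of 1]
      have "eventually (\<lambda>r. max_modulus r ?F \<le> exp (r powr s')) at_top"
      proof eventually_elim
        case (elim r)
        have "max_modulus r ?F \<le> 2 * (D * ((?X r + 1) * (E * r) powr (?X r + 1) + 2))"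
        proof (rule max_modulus_le)
          fix z :: complex assume "z \<in> sphere 0 r"
          then have z: "norm z = r" by simp
          show "norm (?F z) \<le> 2 * (D * ((?X r + 1) * (E * r) powr (?X r + 1) + 2))"
            using A(2)[OF z elim(1)] B(2)[OF z elim(1)]
              norm_triangle_ineq[of "\<Sum>k. a k * z ^ k" "cnj (\<Sum>k. b k * z ^ k)"]
            unfolding complex_mod_cnj by linarith
        qed (use elim in simp)
        with elim show ?case by linarith
      qed
      with lim real show ?thesis by (simp add: growth_order_le)
    qed auto
  qed
qed

section \<open>Entire mappings from small gaps\<close>

text \<open>The first form is for a full gap, where the offset is \<open>Suc d\<close>; the second
  is for an index inside a gap. They follow from (d+1)^2 (d+1)! = (d+1)^3 d!, d + 1 \<le> 2^d and d!
  \<le> d^d.\<close>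

lemma sq_mult_fact_le:
  assumes "d \<ge> 1"
  shows "real (Suc d) ^ 2 * fact (Suc d) \<le> (8 * real d) ^ d" "real d ^ 2 * fact d \<le> (8 * real d) ^ d"
proof -
  have f: "(fact d :: real) \<le> real d ^ d"
    using fact_le_power[of d, where 'a = real] by simp
  have 2: "real (Suc d) \<le> 2 ^ d"
    using less_exp[of d] by (metis Suc_leI of_nat_le_iff of_nat_numeral of_nat_power)
  have "real (Suc d) ^ 3 \<le> (2 ^ d) ^ 3"
    using 2 by (intro power_mono) auto
  also have "\<dots> = (8::real) ^ d"
    by (simp add: power_mult[symmetric] mult.commute[of d]) (simp add: power_mult)
  finally have 8: "real (Suc d) ^ 3 \<le> 8 ^ d" .
  have "real (Suc d) ^ 2 * fact (Suc d) = real (Suc d) ^ 3 * fact d"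
    by (simp add: power2_eq_square power3_eq_cube)
  also have "\<dots> \<le> 8 ^ d * real d ^ d"
    using 8 f by (intro mult_mono) auto
  finally show 1: "real (Suc d) ^ 2 * fact (Suc d) \<le> (8 * real d) ^ d"
    by (simp add: power_mult_distrib)
  have "real d ^ 2 * fact d \<le> real (Suc d) ^ 2 * fact (Suc d)"
    by (intro mult_mono power_mono fact_mono) auto
  with 1 show "real d ^ 2 * fact d \<le> (8 * real d) ^ d" by linarith
qed

text \<open>\<open>rec\<close> is iterated from the start of one gap to the start of the next, and
  applied once more to reach an index inside a gap. The exponents of the collected factors add up to
  at most that index.\<close>

lemma coeff_bound_of_small_gaps:
  fixes M :: "nat \<Rightarrow> real"
  assumes n: "strict_mono n" and \<beta>: "0 \<le> \<beta>" "\<beta> < 1" and M: "\<And>j. M j \<ge> 0"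
    and gap: "eventually (\<lambda>p. real (n (Suc p)) - real (n p) \<le> real (n (Suc p)) powr \<beta>) sequentially"
    and rec: "\<And>p k. k \<ge> 1 \<Longrightarrow> M (n p + k) \<le> real k ^ 2 * fact k * M (n p + 1)"
  shows "\<exists>C J. C \<ge> 0 \<and> (\<forall>j\<ge>J. M j \<le> C * (16 * real j powr \<beta>) ^ j)"
proof -
  \<comment> \<open>Since \<beta> < 1, late gaps are at most half of their right end, so
    \<open>n (Suc p)\<close> is at most twice \<open>n p\<close>.\<close>
  have "eventually (\<lambda>x::real. x powr \<beta> \<le> x / 2) at_top"
    using \<beta> by real_asymp
  then have "eventually (\<lambda>x. x powr \<beta> \<le> x / 2 \<and> x \<ge> 1) at_top"
    using eventually_ge_at_top eventually_conj by blast
  then have "eventually (\<lambda>p. real (n p) powr \<beta> \<le> real (n p) / 2 \<and> real (n p) \<ge> 1) sequentially"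
    using filterlim_compose[OF filterlim_real_sequentially filterlim_subseq[OF n]]
    by (rule eventually_compose_filterlim)
  with gap have "eventually (\<lambda>p. real (n (Suc p)) - real (n p) \<le> real (n (Suc p)) powr \<beta> \<and>
      real (n p) powr \<beta> \<le> real (n p) / 2 \<and> real (n p) \<ge> 1) sequentially"
    by eventually_elim auto
  then obtain P where "\<And>p. p \<ge> P \<Longrightarrow> real (n (Suc p)) - real (n p) \<le> real (n (Suc p)) powr \<beta> \<and>
      real (n p) powr \<beta> \<le> real (n p) / 2 \<and> real (n p) \<ge> 1"
    unfolding eventually_sequentially by auto
  then have gap: "\<And>p. p \<ge> P \<Longrightarrow> real (n (Suc p)) - real (n p) \<le> real (n (Suc p)) powr \<beta>"
    and half: "\<And>p. p \<ge> P \<Longrightarrow> real (n p) powr \<beta> \<le> real (n p) / 2"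
    and n1: "\<And>p. p \<ge> P \<Longrightarrow> real (n p) \<ge> 1"
    by blast+
  define T where "T = (\<lambda>p. 8 * real (n p) powr \<beta>)"
  have powr1: "real j powr \<beta> \<ge> 1" if "j \<ge> 1" for j
    using that \<beta> by (intro ge_one_powr_ge_zero) auto
  \<comment> \<open>The gaps sum to \<open>n p - n P\<close> and \<open>T\<close> increases, so the
    telescoped product is at most \<open>T p ^ n p\<close>; the surplus exponent \<open>n P\<close>
    does no harm because \<open>T P\<close> is at least 1.\<close>
  have C: "M (n p + 1) \<le> M (n P + 1) * T p ^ n p" if "p \<ge> P" for p
    using that
  proof (induction p rule: dec_induct)
    case base
    have "1 \<le> T P ^ n P"
      using powr1[of "n P"] n1[of P] by (intro one_le_power) (auto simp: T_def)
    then show ?case using M[of "n P + 1"] by (simp add: mult_le_cancel_left1)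
  next
    case (step p)
    define d where "d = n (Suc p) - n p"
    have lt: "n p < n (Suc p)" using n by (simp add: strict_mono_Suc_iff)
    then have d: "d \<ge> 1" "n (Suc p) = n p + d" by (auto simp: d_def)
    have TT: "0 \<le> T p" "T p \<le> T (Suc p)"
      using lt \<beta> by (auto simp: T_def intro!: powr_mono2)
    have "M (n (Suc p) + 1) = M (n p + Suc d)" by (simp add: d)
    also have "\<dots> \<le> real (Suc d) ^ 2 * fact (Suc d) * M (n p + 1)"
      by (rule rec) simp
    also have "\<dots> \<le> (8 * real d) ^ d * M (n p + 1)"
      by (intro mult_right_mono sq_mult_fact_le d M)
    also have "\<dots> \<le> T (Suc p) ^ d * M (n p + 1)"
      using gap[OF step.hyps(1)] d by (intro mult_right_mono power_mono M) (auto simp: T_def)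
    also have "\<dots> \<le> T (Suc p) ^ d * (M (n P + 1) * T (Suc p) ^ n p)"
    proof (rule mult_left_mono)
      have "M (n P + 1) * T p ^ n p \<le> M (n P + 1) * T (Suc p) ^ n p"
        using TT by (intro mult_left_mono power_mono M)
      with step.IH show "M (n p + 1) \<le> M (n P + 1) * T (Suc p) ^ n p" by linarith
      show "0 \<le> T (Suc p) ^ d" using TT by simp
    qed
    finally show ?case by (simp add: d(2) power_add mult_ac)
  qed
  have "M j \<le> M (n P + 1) * (16 * real j powr \<beta>) ^ j" if j: "j > n P" for j
  proof -
    have "\<exists>p\<ge>P. n p < j \<and> j \<le> n (Suc p)"
    proof -
      \<comment> \<open>The gap containing \<open>j\<close> starts at the largest p with
        \<open>n p < j\<close>.\<close>
      define Q where "Q = {p. n p < j}"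
      have "finite Q"
        by (rule finite_subset[of _ "{..j}"])
          (use strict_mono_imp_increasing[OF n] in \<open>auto simp: Q_def intro: order_trans less_imp_le\<close>)
      moreover have "P \<in> Q" using j by (simp add: Q_def)
      ultimately have "Max Q \<in> Q" "P \<le> Max Q" "Suc (Max Q) \<notin> Q"
        using Max_in[of Q] Max_ge[of Q "Suc (Max Q)"] Max_ge[of Q P] not_less_eq_eq by blast+
      then show ?thesis by (auto simp: Q_def)
    qed
    then obtain p where p: "p \<ge> P" "n p < j" "j \<le> n (Suc p)" by blast
    define k where "k = j - n p"
    have k: "k \<ge> 1" "j = n p + k" using p by (auto simp: k_def)
    \<comment> \<open>The gap may end beyond \<open>j\<close>, but at most at 2 j. This costs a
      factor of at most 2 and turns the 8 of \<open>sq_mult_fact_le\<close> into 16.\<close>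
    have kb: "real k \<le> 2 * real j powr \<beta>"
    proof -
      have g: "real (n (Suc p)) - real (n p) \<le> real (n (Suc p)) powr \<beta>"
        using gap p by simp
      also have "\<dots> \<le> real (n (Suc p)) / 2" using half[of "Suc p"] p by simp
      finally have le: "real (n (Suc p)) \<le> 2 * real j" using p by simp
      have "real k \<le> real (n (Suc p)) - real (n p)" using p k by simp
      also note g
      also have "real (n (Suc p)) powr \<beta> \<le> (2 * real j) powr \<beta>"
        using le \<beta> by (intro powr_mono2) auto
      also have "\<dots> = 2 powr \<beta> * real j powr \<beta>" by (simp add: powr_mult)
      also have "(2::real) powr \<beta> \<le> 2 powr 1" using \<beta> by (intro powr_mono) auto
      finally show ?thesis by (simp add: mult_right_mono)
    qed
    have "M j \<le> real k ^ 2 * fact k * M (n p + 1)"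
      unfolding k(2) by (rule rec[OF k(1)])
    also have "\<dots> \<le> (8 * real k) ^ k * M (n p + 1)"
      by (intro mult_right_mono sq_mult_fact_le k M)
    also have "\<dots> \<le> (16 * real j powr \<beta>) ^ k * (M (n P + 1) * (16 * real j powr \<beta>) ^ n p)"
    proof (rule mult_mono)
      show "(8 * real k) ^ k \<le> (16 * real j powr \<beta>) ^ k"
        using kb by (intro power_mono) auto
      have "real (n p) powr \<beta> \<le> real j powr \<beta>"
        using p \<beta> by (intro powr_mono2) auto
      then have "T p \<le> 16 * real j powr \<beta>"
        unfolding T_def by (intro mult_mono) auto
      then have "M (n P + 1) * T p ^ n p \<le> M (n P + 1) * (16 * real j powr \<beta>) ^ n p"
        by (intro mult_left_mono power_mono M) (auto simp: T_def)
      with C[OF p(1)] show "M (n p + 1) \<le> M (n P + 1) * (16 * real j powr \<beta>) ^ n p" by linarith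
    qed (use M in auto)
    also have "\<dots> = M (n P + 1) * (16 * real j powr \<beta>) ^ (k + n p)"
      by (simp add: power_add)
    also have "k + n p = j" using k by simp
    finally show ?thesis .
  qed
  then show ?thesis
    using M[of "n P + 1"] by (intro exI[of _ "M (n P + 1)"] exI[of _ "Suc (n P)"]) auto
qed

text \<open>The quotient j^j / j! is a single term of the exponential series of e^j, and e \<le>
  3.\<close>

lemma power_self_le_fact_mult: "real j ^ j \<le> 3 ^ j * fact j"
proof -
  have "real j ^ j /\<^sub>R fact j \<le> exp (real j)"
    unfolding exp_def
    using sum_le_suminf[OF summable_exp_generic[of "real j"], of "{j}"] by simp
  also have "\<dots> = exp 1 ^ j" by (simp add: exp_of_nat_mult flip: exp_of_nat_mult)
  also have "\<dots> \<le> 3 ^ j" using exp_le by (intro power_mono) auto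
  finally show ?thesis by (simp add: field_simps)
qed

text \<open>A gap lies between 1 and its right end, so every quotient is in [0, 1]; for right end 1
  it is 0 / 0 = 0.\<close>

lemma rho_star_limsup:
  assumes n: "strict_mono n"
  obtains l where "0 \<le> l" "l \<le> 1"
    "limsup (\<lambda>p. ereal (ln (real (n (Suc p)) - real (n p)) / ln (real (n (Suc p))))) = ereal l"
proof -
  let ?x = "\<lambda>p. ereal (ln (real (n (Suc p)) - real (n p)) / ln (real (n (Suc p))))"
  have x: "0 \<le> ?x p \<and> ?x p \<le> 1" for p
  proof -
    have "n p < n (Suc p)" using n by (simp add: strict_mono_Suc_iff)
    then have 1: "real (n (Suc p)) - real (n p) \<ge> 1" "real (n (Suc p)) - real (n p) \<le> real (n (Suc p))"
      by auto
    then have "0 \<le> ln (real (n (Suc p)) - real (n p))"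
      "ln (real (n (Suc p)) - real (n p)) \<le> ln (real (n (Suc p)))"
      by auto
    then show ?thesis
      by (auto simp: divide_le_eq_1 intro!: divide_nonneg_nonneg)
  qed
  have "0 \<le> limsup ?x" using x by (intro le_Limsup) auto
  moreover have "limsup ?x \<le> 1" using x by (intro Limsup_bounded) auto
  ultimately show ?thesis
    by (cases "limsup ?x") (auto intro: that)
qed

text \<open>For each \<beta> strictly between the upper limit l and 1, the gaps are eventually at
  most \<open>n (Suc p) powr \<beta>\<close>, which yields order at most 1 / (1 - \<beta>). Letting
  \<beta> decrease to l gives \<open>rho_star n\<close>.\<close>

lemma admissible_pair_entire_of_finite_order:
  assumes adm: "admissible_pair f n" and fin: "rho_star n < \<infinity>"
  shows "\<exists>F. harmonic_entire_extension f F \<and> growth_order F \<le> rho_star n"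
proof -
  have n: "strict_mono n" using adm by (simp add: admissible_pair_def)
  obtain l where l: "0 \<le> l" "l \<le> 1"
    "limsup (\<lambda>p. ereal (ln (real (n (Suc p)) - real (n p)) / ln (real (n (Suc p))))) = ereal l"
    using rho_star_limsup[OF n] .
  have "l \<noteq> 1"
    using fin by (auto simp: rho_star_def l(3) one_ereal_def[symmetric])
  with l have l1: "l < 1" by simp
  then have rho: "rho_star n = ereal (1 / (1 - l))"
    by (simp add: rho_star_def l(3) one_ereal_def)
  obtain h g a b where E: "harmonic_expansion f h g a b"
    and pos: "\<And>p. max (norm (a (n p + 1))) (norm (b (n p + 1))) > 0"
    and bd: "\<And>p k. k \<ge> 1 \<Longrightarrow> fact (n p + k) * max (norm (a (n p + k))) (norm (b (n p + k))) \<le>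
        real k ^ 2 * fact k * (fact (n p + 1) * max (norm (a (n p + 1))) (norm (b (n p + 1))))"
    using admissible_pair_coeff_bound[OF adm] by blast
  define M where "M = (\<lambda>j. fact j * max (norm (a j)) (norm (b j)))"
  have decay: "\<exists>C J. \<forall>j\<ge>J. norm (a j) \<le> C * (48 / real j powr (1 - \<beta>)) ^ j \<and>
      norm (b j) \<le> C * (48 / real j powr (1 - \<beta>)) ^ j" if \<beta>: "l < \<beta>" "\<beta> < 1" for \<beta>
  proof -
    have "eventually (\<lambda>p. ereal (ln (real (n (Suc p)) - real (n p)) / ln (real (n (Suc p)))) < ereal \<beta>) sequentially"
      using \<beta> l by (intro Limsup_lessD) simp
    with eventually_gt_at_top[of 0]
    have gap: "eventually (\<lambda>p. real (n (Suc p)) - real (n p) \<le> real (n (Suc p)) powr \<beta>) sequentially"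
    proof eventually_elim
      case (elim p)
      have lt: "n p < n (Suc p)" "n 0 < n p" using n elim by (auto simp: strict_mono_less)
      then have "ln (real (n (Suc p))) > 0" by simp
      with elim have "ln (real (n (Suc p)) - real (n p)) < \<beta> * ln (real (n (Suc p)))"
        by (simp add: divide_less_eq)
      also have "\<dots> = ln (real (n (Suc p)) powr \<beta>)" using lt by (simp add: ln_powr)
      finally show ?case using lt by (subst (asm) ln_less_cancel_iff) auto
    qed
    then obtain C J where CJ: "C \<ge> 0" "\<And>j. j \<ge> J \<Longrightarrow> M j \<le> C * (16 * real j powr \<beta>) ^ j"
    proof -
      have "\<exists>C J. C \<ge> 0 \<and> (\<forall>j\<ge>J. M j \<le> C * (16 * real j powr \<beta>) ^ j)"
      proof (rule coeff_bound_of_small_gaps[OF n])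
        show "M (n p + k) \<le> real k ^ 2 * fact k * M (n p + 1)" if "k \<ge> 1" for p k
          using bd[OF that] by (simp add: M_def)
        show "M j \<ge> 0" for j by (simp add: M_def le_max_iff_disj)
      qed (use \<beta> l gap in auto)
      then show ?thesis using that by blast
    qed
    \<comment> \<open>The constant 48 is 16 from the gap estimate times 3 from the comparison of j^j
      with j!.\<close>
    have "max (norm (a j)) (norm (b j)) \<le> C * (48 / real j powr (1 - \<beta>)) ^ j" if j: "j \<ge> max J 1" for j
    proof -
      define m where "m = max (norm (a j)) (norm (b j))"
      have "m * real j ^ j \<le> m * (3 ^ j * fact j)"
        by (intro mult_left_mono power_self_le_fact_mult) (simp add: m_def le_max_iff_disj)
      also have "\<dots> = 3 ^ j * M j" by (simp add: M_def m_def)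
      also have "\<dots> \<le> 3 ^ j * (C * (16 * real j powr \<beta>) ^ j)"
        using CJ(2)[of j] j by (intro mult_left_mono) auto
      also have "\<dots> = C * (48 * real j powr \<beta>) ^ j"
        using power_mult_distrib[of "3::real" 16 j] by (simp add: power_mult_distrib)
      finally have "m \<le> C * (48 * real j powr \<beta> / real j) ^ j"
        using j by (simp add: field_simps power_divide)
      also have "48 * real j powr \<beta> / real j = 48 / real j powr (1 - \<beta>)"
        using j by (simp add: powr_diff)
      finally show ?thesis unfolding m_def .
    qed
    then show ?thesis by (intro exI[of _ C] exI[of _ "max J 1"]) auto
  qed
  \<comment> \<open>\<open>F\<close> does not depend on \<beta>, so the order bounds for all \<beta>
    concern the same function.\<close>
  define F where "F = (\<lambda>z. (\<Sum>k. a k * z ^ k) + cnj (\<Sum>k. b k * z ^ k))"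
  have nz: "a (n 0 + 1) \<noteq> 0 \<or> b (n 0 + 1) \<noteq> 0" using pos[of 0] by auto
  have order: "growth_order F \<le> ereal (1 / (1 - \<beta>))" if \<beta>: "l < \<beta>" "\<beta> < 1" for \<beta>
  proof -
    obtain C J where "\<forall>j\<ge>J. norm (a j) \<le> C * (48 / real j powr (1 - \<beta>)) ^ j \<and>
      norm (b j) \<le> C * (48 / real j powr (1 - \<beta>)) ^ j"
      using decay[OF \<beta>] by blast
    then show ?thesis
      unfolding F_def using \<beta> nz
      by (intro growth_order_powser_le(3)[of J a C 48 "1 - \<beta>" b "n 0 + 1"]) auto
  qed
  have "harmonic_entire_extension f F"
  proof -
    obtain \<beta> where \<beta>: "l < \<beta>" "\<beta> < 1" using l1 dense by blast
    obtain C J where CJ: "\<forall>j\<ge>J. norm (a j) \<le> C * (48 / real j powr (1 - \<beta>)) ^ j \<and>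
      norm (b j) \<le> C * (48 / real j powr (1 - \<beta>)) ^ j"
      using decay[OF \<beta>] by blast
    have "summable (\<lambda>k. a k * z ^ k) \<and> summable (\<lambda>k. b k * z ^ k)" for z
      using growth_order_powser_le(1,2)[of J a C 48 "1 - \<beta>" b z] CJ \<beta> by auto
    then show ?thesis
      unfolding F_def by (intro harmonic_entire_extension_powser[OF E]) auto
  qed
  moreover have "growth_order F \<le> rho_star n"
  proof -
    have "((\<lambda>\<beta>. ereal (1 / (1 - \<beta>))) \<longlongrightarrow> ereal (1 / (1 - l))) (at_right l)"
      using l1 by (auto intro!: tendsto_eq_intros)
    moreover have "eventually (\<lambda>\<beta>. growth_order F \<le> ereal (1 / (1 - \<beta>))) (at_right l)"
      using eventually_at_right_real[OF l1] by eventually_elim (auto intro: order)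
    ultimately show ?thesis
      unfolding rho by (rule tendsto_lowerbound) simp
  qed
  ultimately show ?thesis by blast
qed

section \<open>Lacunary examples\<close>

text \<open>On the disc the k-th powers of z and w differ by at most k |z - w|. The terms from index
  2 on thus contribute at most |z - w| / 2 to H z - H w and cannot cancel the linear term.\<close>

lemma inj_on_powser_small_coeffs:
  fixes H :: "complex \<Rightarrow> complex"
  assumes H: "\<And>z. z \<in> ball 0 1 \<Longrightarrow> (\<lambda>k. A k * z ^ k) sums H z"
    and A1: "A 1 = 1" and A: "\<And>k. k \<ge> 2 \<Longrightarrow> real k * norm (A k) \<le> (1/2) ^ k"
  shows "inj_on H (ball 0 1)"
proof (rule inj_onI, rule ccontr)
  fix z w :: complex assume z: "z \<in> ball 0 1" and w: "w \<in> ball 0 1" and eq: "H z = H w" and ne: "z \<noteq> w"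
  define t where "t = (\<lambda>k. A k * (z ^ k - w ^ k))"
  have "t sums 0"
    using sums_diff[OF H[OF z] H[OF w]] eq by (simp add: t_def algebra_simps)
  then have "(\<lambda>k. t (k + 2)) sums (0 - (\<Sum>k<2. t k))"
    by (subst sums_iff_shift) simp
  also have "(\<Sum>k<2. t k) = z - w"
    using A1 by (simp add: t_def numeral_2_eq_2)
  finally have t: "(\<lambda>k. t (k + 2)) sums (w - z)" by simp
  have bd: "norm (t (k + 2)) \<le> norm (z - w) / 4 * (1/2) ^ k" for k
  proof -
    have "norm (t (k + 2)) \<le> norm (A (k + 2)) * (real (k + 2) * norm (z - w))"
      unfolding t_def norm_mult using z w
      by (intro mult_left_mono norm_power_diff) auto
    also have "\<dots> = real (k + 2) * norm (A (k + 2)) * norm (z - w)" by simp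
    also have "\<dots> \<le> (1/2) ^ (k + 2) * norm (z - w)"
      by (intro mult_right_mono A) auto
    finally show ?thesis by (simp add: field_simps)
  qed
  have g: "(\<lambda>k. norm (z - w) / 4 * (1/2::real) ^ k) sums (norm (z - w) / 4 * (1 / (1 - 1/2)))"
    by (intro sums_mult geometric_sums) simp
  have "norm (\<Sum>k. t (k + 2)) \<le> (\<Sum>k. norm (z - w) / 4 * (1/2) ^ k)"
    by (intro norm_suminf_le bd sums_summable[OF g])
  then have "norm (w - z) \<le> norm (z - w) / 4 * (1 / (1 - 1/2))"
    using sums_unique[OF t] sums_unique[OF g] by simp
  then show False
    using ne by (simp add: norm_minus_commute)
qed

text \<open>With zero co-analytic part the dilatation 0 is admissible, and injectivity already
  excludes a constant function.\<close>

lemma analytic_in_S_Hc: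
  assumes E: "harmonic_expansion Q H (\<lambda>_. 0) A (\<lambda>_. 0)"
    and A01: "A 0 = 0" "A 1 = 1" and A: "\<And>k. k \<ge> 2 \<Longrightarrow> real k * norm (A k) \<le> (1/2) ^ k"
  shows "Q \<in> S_Hc"
proof -
  have inj: "inj_on Q (ball 0 1)"
    using E A01 A unfolding harmonic_expansion_def
    by (intro inj_on_powser_small_coeffs[of A]) auto
  have "\<not> Q constant_on ball 0 1"
  proof
    assume "Q constant_on ball 0 1"
    then have "Q 0 = Q (1/2)" by (auto simp: constant_on_def)
    then have "(0::complex) = 1/2" by (rule inj_onD[OF inj]) auto
    then show False by simp
  qed
  then have "sense_preserving Q H (\<lambda>_. 0)"
    unfolding sense_preserving_def by (auto intro!: exI[of _ "\<lambda>_. 0"])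
  then have "Q \<in> S_H"
    unfolding S_H_def using E A01 inj by blast
  moreover have "norm (A k) < (2 * real k ^ 2 + 1) / 3" if k: "k \<ge> 2" for k
  proof -
    have "norm (A k) \<le> real k * norm (A k)"
      using k by (simp add: mult_le_cancel_right1)
    also have "\<dots> \<le> (1/2) ^ k" by (rule A[OF k])
    also have "\<dots> \<le> 1" by (simp add: power_le_one)
    also have "1 < (2 * real k ^ 2 + 1) / 3"
      using k power_strict_mono[of 1 "real k" 2] by simp
    finally show ?thesis .
  qed
  moreover have "0 < (2 * real k ^ 2 + 1) / 3" for k
    by (simp add: add_nonneg_pos)
  ultimately have "Q \<in> S_H \<and> harmonic_expansion Q H (\<lambda>_. 0) A (\<lambda>_. 0) \<and>
      (\<forall>k\<ge>2. norm (A k) < (2 * real k ^ 2 + 1) / 3 \<and> norm (0::complex) < (2 * real k ^ 2 + 1) / 3)"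
    using E by simp
  then show ?thesis
    unfolding S_Hc_def mem_Collect_eq by blast
qed

text \<open>\<open>binom\<close> says that k times the k-th coefficient of a normalised derivative
  is tiny, where k = N q - N p + 1. \<open>N2\<close> keeps gaps comparable to their right end,
  which forces \<open>rho_star\<close> to be infinite; \<open>c_small\<close> gives convergence on
  the disc.\<close>

locale lacunary =
  fixes N :: "nat \<Rightarrow> nat" and c :: "nat \<Rightarrow> real"
  assumes N: "strict_mono N" and N0: "N 0 \<ge> 1"
    and N2: "\<And>q. N (Suc q) \<ge> 2 * N q"
    and c_pos: "\<And>q. 0 < c (N q)" and c_small: "\<And>q. c (N q) \<le> (1/4) ^ N q"
    and binom: "\<And>p q. p < q \<Longrightarrow> real (N q choose N p) * c (N q) \<le> (1/2) ^ N q * c (N p)"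
begin

definition coeff :: "nat \<Rightarrow> complex" where
  "coeff k = (if k \<in> range N then of_real (c k) else 0)"

definition series :: "complex \<Rightarrow> complex" where
  "series z = (\<Sum>k. coeff k * z ^ k)"

text \<open>The normalisation divides by the coefficient of index \<open>idx p + 1\<close>, which
  must be the nonzero one at \<open>N p\<close>.\<close>

definition idx :: "nat \<Rightarrow> nat" where
  "idx p = N p - 1"

lemma N_ge_1: "N p \<ge> 1"
  using N0 strict_mono_less_eq[OF N, of 0 p] by linarith

lemma Suc_idx: "Suc (idx p) = N p"
  using N_ge_1[of p] by (simp add: idx_def)

lemma coeff_N: "coeff (N p) = of_real (c (N p))"
  by (simp add: coeff_def)

lemma norm_coeff: "norm (coeff k) = (if k \<in> range N then c k else 0)"
  using c_pos by (auto simp: coeff_def less_imp_le)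

lemma coeff_sums:
  assumes "z \<in> ball 0 1"
  shows "(\<lambda>k. coeff k * z ^ k) sums series z"
  unfolding series_def
proof (rule summable_sums, rule summable_comparison_test'[of "\<lambda>k. (1/4::real) ^ k" 0])
  fix k :: nat
  have "norm (coeff k) \<le> (1/4) ^ k"
    using c_small by (auto simp: norm_coeff)
  moreover have "norm z ^ k \<le> 1"
    using assms by (intro power_le_one) auto
  ultimately have "norm (coeff k) * norm z ^ k \<le> (1/4) ^ k * 1"
    by (intro mult_mono) auto
  then show "norm (coeff k * z ^ k) \<le> (1/4) ^ k"
    by (simp add: norm_mult norm_power)
qed (auto intro: summable_geometric)

lemma series_holomorphic: "series holomorphic_on ball 0 1"
  using coeff_sums by (intro power_series_holomorphic[of 0 1 coeff]) auto

lemma expansion: "harmonic_expansion series series (\<lambda>_. 0) coeff (\<lambda>_. 0)"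
  using series_holomorphic coeff_sums by (auto simp: harmonic_expansion_def)

text \<open>A nonzero coefficient has index k = N q - N p + 1. Since k! = k (N q - N p)!, the factor
  k cancels and leaves a binomial coefficient, to which \<open>binom\<close> applies.\<close>

lemma quotient_coeff_small:
  assumes k: "k \<ge> 2"
  shows "real k * norm (quotient_coeff (idx p) coeff (fact (N p) * coeff (N p)) k) \<le> (1/2) ^ k"
proof (cases "idx p + k \<in> range N")
  case True
  then obtain q where q: "idx p + k = N q" by blast
  then have "N p < N q" using Suc_idx[of p] k by linarith
  then have pq: "p < q" and NN: "N p \<le> N q"
    using strict_mono_less[OF N] less_imp_le by blast+
  have kk: "fact k = real k * fact (N q - N p)"
  proof -
    have "k = Suc (N q - N p)" using q Suc_idx[of p] k by linarith
    then show ?thesis by simp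
  qed
  have "real k * norm (quotient_coeff (idx p) coeff (fact (N p) * coeff (N p)) k)
      = fact (N q) / (fact (N p) * fact (N q - N p)) * c (N q) / c (N p)"
    using k c_pos[of p] c_pos[of q]
    by (simp add: quotient_coeff_def q norm_mult norm_divide norm_coeff kk)
  also have "\<dots> = real (N q choose N p) * c (N q) / c (N p)"
    by (simp add: binomial_fact[OF NN])
  also have "\<dots> \<le> (1/2) ^ N q"
    using binom[OF pq] c_pos[of p] by (simp add: divide_le_eq)
  also have "\<dots> \<le> (1/2) ^ k"
    using q by (intro power_decreasing) auto
  finally show ?thesis .
next
  case False
  then show ?thesis by (simp add: quotient_coeff_def coeff_def)
qed

lemma admissible: "admissible_pair series idx"
proof -
  have "harmonic_on (\<lambda>z. series z + cnj 0) (ball 0 1)"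
    by (intro harmonic_on_holomorphic_plus_cnj series_holomorphic) auto
  then have harm: "harmonic_on series (ball 0 1)" by simp
  have "Suc (idx p) < Suc (idx q)" if "p < q" for p q
    unfolding Suc_idx using N that by (simp add: strict_mono_less)
  then have mono: "strict_mono idx" by (auto simp: strict_mono_def)
  have mem: "(\<lambda>z. (harmonic_deriv (idx p) series (\<lambda>_. 0) z - fact (idx p) * coeff (idx p) - fact (idx p) * cnj 0)
             / (fact (idx p + 1) * coeff (idx p + 1))) \<in> S_Hc" for p
  proof -
    let ?c = "fact (N p) * coeff (N p)"
    have cnz: "?c \<noteq> 0" using c_pos[of p] by (simp add: coeff_N)
    have "harmonic_expansion
       (\<lambda>z. (harmonic_deriv (idx p) series (\<lambda>_. 0) z - fact (idx p) * coeff (idx p) - fact (idx p) * cnj 0) / ?c)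
       (\<lambda>z. ((deriv ^^ idx p) series z - fact (idx p) * coeff (idx p)) / ?c)
       (\<lambda>z. ((deriv ^^ idx p) (\<lambda>_. 0) z - fact (idx p) * 0) / cnj ?c)
       (quotient_coeff (idx p) coeff ?c) (quotient_coeff (idx p) (\<lambda>_. 0) (cnj ?c))"
      by (rule harmonic_expansion_quotient[where b = "\<lambda>_. 0"]) (auto intro: series_holomorphic coeff_sums)
    also have "(\<lambda>z. ((deriv ^^ idx p) (\<lambda>_. 0) z - fact (idx p) * 0) / cnj ?c) = (\<lambda>_. 0)"
      by (simp add: higher_deriv_const)
    also have "quotient_coeff (idx p) (\<lambda>_. 0) (cnj ?c) = (\<lambda>_. 0)"
      by (simp add: quotient_coeff_def fun_eq_iff)
    finally have E: "harmonic_expansion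
       (\<lambda>z. (harmonic_deriv (idx p) series (\<lambda>_. 0) z - fact (idx p) * coeff (idx p) - fact (idx p) * cnj 0) / ?c)
       (\<lambda>z. ((deriv ^^ idx p) series z - fact (idx p) * coeff (idx p)) / ?c)
       (\<lambda>_. 0) (quotient_coeff (idx p) coeff ?c) (\<lambda>_. 0)" .
    have 1: "quotient_coeff (idx p) coeff ?c 1 = 1"
      using cnz Suc_idx[of p] by (simp add: quotient_coeff_def del: fact_Suc)
    show ?thesis
      using analytic_in_S_Hc[OF E _ 1 quotient_coeff_small] Suc_idx[of p]
      by (simp add: quotient_coeff_def del: fact_Suc)
  qed
  \<comment> \<open>The co-analytic coefficients vanish and the analytic one does not, so only the
    first alternative of \<open>admissible_pair\<close> occurs.\<close>
  have nz: "\<not> norm (coeff (idx p + 1)) \<le> norm (0::complex)" for p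
    using c_pos[of p] by (simp add: Suc_idx coeff_N)
  show ?thesis
    unfolding admissible_pair_def
    by (intro conjI harm mono, rule exI[of _ series], rule exI[of _ "\<lambda>_. 0"],
        rule exI[of _ coeff], rule exI[of _ "\<lambda>_. 0"])
      (use expansion mem nz in blast)
qed

text \<open>Each gap is at least half of its right end x, so the quotient lies between (ln x - ln 2)
  / ln x and 1.\<close>

lemma rho_star_idx: "rho_star idx = \<infinity>"
proof -
  let ?x = "\<lambda>p. ln (real (idx (Suc p)) - real (idx p)) / ln (real (idx (Suc p)))"
  have "filterlim (\<lambda>p. N (Suc p)) at_top sequentially"
    using filterlim_compose[OF filterlim_subseq[OF N] filterlim_Suc] .
  then have "filterlim (\<lambda>p. N (Suc p) - 1) at_top sequentially"
    using filterlim_minus_const_nat_at_top[of 1] filterlim_compose by blast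
  then have lim: "filterlim (\<lambda>p. real (idx (Suc p))) at_top sequentially"
    unfolding idx_def by (rule filterlim_compose[OF filterlim_real_sequentially])
  have "((\<lambda>x::real. (ln x - ln 2) / ln x) \<longlongrightarrow> 1) at_top" by real_asymp
  then have lower: "(\<lambda>p. (ln (real (idx (Suc p))) - ln 2) / ln (real (idx (Suc p)))) \<longlonglongrightarrow> 1"
    using lim by (rule filterlim_compose)
  have "eventually (\<lambda>p. real (idx (Suc p)) > 1) sequentially"
    by (rule eventually_compose_filterlim[OF eventually_gt_at_top lim])
  then have bds: "eventually (\<lambda>p. (ln (real (idx (Suc p))) - ln 2) / ln (real (idx (Suc p))) \<le> ?x p \<and> ?x p \<le> 1) sequentially"
  proof eventually_elim
    case (elim p)
    have "2 * idx p \<le> idx (Suc p)" using N2[of p] by (simp add: idx_def)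
    then have d: "real (idx (Suc p)) / 2 \<le> real (idx (Suc p)) - real (idx p)" by simp
    have "ln (real (idx (Suc p))) - ln 2 = ln (real (idx (Suc p)) / 2)"
      using elim by (simp add: ln_div)
    also have "\<dots> \<le> ln (real (idx (Suc p)) - real (idx p))"
      using d elim by (subst ln_le_cancel_iff) auto
    finally have 1: "ln (real (idx (Suc p))) - ln 2 \<le> ln (real (idx (Suc p)) - real (idx p))" .
    have "ln (real (idx (Suc p)) - real (idx p)) \<le> ln (real (idx (Suc p)))"
      using d elim by (subst ln_le_cancel_iff) auto
    with 1 elim show ?case
      by (auto intro!: divide_right_mono)
  qed
  have "?x \<longlonglongrightarrow> 1"
    by (rule tendsto_sandwich[OF _ _ lower tendsto_const]) (use bds in \<open>auto elim: eventually_mono\<close>)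
  then have "limsup (\<lambda>p. ereal (?x p)) = 1"
    by (intro lim_imp_Limsup) (auto simp: one_ereal_def)
  then show ?thesis
    by (simp add: rho_star_def)
qed

text \<open>The radius of convergence is 4. At the point 8 the differentiated series has terms N 2^N
  / 8 at the lacunary indices; these stay above 1/8, so they do not tend to 0.\<close>

lemma not_entire:
  assumes c: "\<And>q. c (N q) = (1/4) ^ N q"
  shows "\<not> harmonic_entire series"
proof
  assume "harmonic_entire series"
  then obtain F where "harmonic_entire_extension series F" by (auto simp: harmonic_entire_def)
  then have "summable (\<lambda>k. of_nat (Suc k) * coeff (Suc k) * 8 ^ k)"
    by (rule harmonic_extension_of_holomorphic_coeffs[OF _ series_holomorphic coeff_sums])
  then have "(\<lambda>k. of_nat (Suc k) * coeff (Suc k) * 8 ^ k) \<longlonglongrightarrow> 0"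
    by (rule summable_LIMSEQ_zero)
  then have "eventually (\<lambda>k. norm (of_nat (Suc k) * coeff (Suc k) * 8 ^ k) < 1/8) sequentially"
    using tendstoD[of _ 0 sequentially "1/8"] unfolding dist_norm diff_zero by fastforce
  then obtain K where K: "\<And>k. k \<ge> K \<Longrightarrow> norm (of_nat (Suc k) * coeff (Suc k) * 8 ^ k) < 1/8"
    by (auto simp: eventually_sequentially)
  have "K \<le> idx (Suc K)"
    using strict_mono_imp_increasing[OF N, of "Suc K"] by (simp add: idx_def)
  from K[OF this] have "real (N (Suc K)) * ((1/4) ^ N (Suc K) * 8 ^ idx (Suc K)) < 1/8"
    by (simp only: Suc_idx norm_mult norm_power norm_coeff c) simp
  also have "(1/4::real) ^ N (Suc K) * 8 ^ idx (Suc K) = 2 ^ N (Suc K) / 8"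
    by (simp flip: Suc_idx add: power_divide)
      (simp add: field_simps flip: power_mult_distrib)
  finally have "real (N (Suc K)) * 2 ^ N (Suc K) < 1" by simp
  moreover have "1 * 1 \<le> real (N (Suc K)) * 2 ^ N (Suc K)"
    using N_ge_1[of "Suc K"] by (intro mult_mono) auto
  ultimately show False by simp
qed

section \<open>Entire lacunary series with coefficients \<open>(1 / \<phi> k) ^ k\<close> and their
  order\<close>

context
  fixes \<phi> :: "nat \<Rightarrow> real"
  assumes \<phi>: "filterlim \<phi> at_top sequentially" and c\<phi>: "\<And>k. c k = (1 / \<phi> k) ^ k"
begin

lemma coeff_summable: "summable (\<lambda>k. coeff k * z ^ k)"
proof -
  have "eventually (\<lambda>k. norm (coeff k * z ^ k) \<le> (1/2) ^ k) sequentially"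
    using filterlim_at_top_dense[THEN iffD1, OF \<phi>, rule_format, of "2 * norm z"]
      filterlim_at_top_dense[THEN iffD1, OF \<phi>, rule_format, of 0]
  proof eventually_elim
    case (elim k)
    have "norm (coeff k * z ^ k) \<le> (1 / \<phi> k) ^ k * norm z ^ k"
      unfolding norm_mult norm_power using elim
      by (intro mult_right_mono) (auto simp: norm_coeff c\<phi>)
    also have "\<dots> = (norm z / \<phi> k) ^ k"
      by (simp add: power_divide)
    also have "\<dots> \<le> (1/2) ^ k"
      using elim by (intro power_mono) (auto simp: field_simps)
    finally show ?case .
  qed
  then show ?thesis
    by (rule summable_comparison_test_ev) (auto intro: summable_geometric)
qed

text \<open>The zero co-analytic series is written out to fit the general lemmas on harmonic power
  series.\<close>

definition entire_series :: "complex \<Rightarrow> complex" where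
  "entire_series z = (\<Sum>k. coeff k * z ^ k) + cnj (\<Sum>k. 0 * z ^ k)"

lemma harmonic_entire_extension_series: "harmonic_entire_extension series entire_series"
  unfolding entire_series_def[abs_def]
  using harmonic_entire_extension_powser[OF expansion coeff_summable] by simp

text \<open>At the radius \<open>exp 1 * \<phi> (N q)\<close> the term of index \<open>N q\<close>
  equals e^(N q). All terms are nonnegative at a positive real point, so the logarithm of the
  maximum modulus is at least \<open>N q\<close>.\<close>

lemma entire_series_order_ge:
  assumes L: "((\<lambda>k. ereal (ln (real k) / ln (exp 1 * \<phi> k))) \<longlongrightarrow> L) sequentially"
  shows "L \<le> growth_order entire_series"
proof (rule growth_order_ge)
  have sub: "filterlim N at_top sequentially" by (rule filterlim_subseq[OF N])
  have \<phi>N: "filterlim (\<lambda>q. \<phi> (N q)) at_top sequentially"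
    using \<phi> sub by (rule filterlim_compose)
  show "filterlim (\<lambda>q. exp 1 * \<phi> (N q)) at_top sequentially"
    by (rule filterlim_tendsto_pos_mult_at_top[OF tendsto_const _ \<phi>N]) simp
  show "(\<lambda>q. ereal (ln (real (N q)) / ln (exp 1 * \<phi> (N q)))) \<longlonglongrightarrow> L"
    using L sub by (rule filterlim_compose)
  have cont: "continuous_on UNIV entire_series"
    unfolding entire_series_def[abs_def]
    by (intro continuous_intros holomorphic_on_imp_continuous_on powser_entire coeff_summable) auto
  have "eventually (\<lambda>q. \<phi> (N q) > 0) sequentially"
    using \<phi>N by (simp add: filterlim_at_top_dense)
  then show "eventually (\<lambda>q. 0 < real (N q) \<and> real (N q) \<le> ln (max_modulus (exp 1 * \<phi> (N q)) entire_series)) sequentially"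
  proof eventually_elim
    case (elim q)
    let ?r = "exp 1 * \<phi> (N q)"
    define t where "t = (\<lambda>k. (if k \<in> range N then c k else 0) * ?r ^ k)"
    have t0: "t k \<ge> 0" for k
      using c_pos elim by (auto simp: t_def less_imp_le intro!: mult_nonneg_nonneg)
    have t_eq: "coeff k * of_real ?r ^ k = of_real (t k)" for k
      by (simp add: t_def coeff_def)
    have sum: "summable t"
      using coeff_summable[of "of_real ?r"] unfolding t_eq by (simp add: summable_of_real_iff)
    have "exp (real (N q)) = t (N q)"
      using elim by (simp add: t_def c\<phi> flip: power_mult_distrib exp_of_nat_mult)
    also have "\<dots> \<le> suminf t"
      using sum_le_suminf[OF sum, of "{N q}"] t0 by simp
    also have "\<dots> \<le> norm (of_real (suminf t) :: complex)" by simp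
    also have "of_real (suminf t) = entire_series (of_real ?r)"
      unfolding entire_series_def t_eq by (simp add: suminf_of_real[OF sum])
    also have "norm (entire_series (of_real ?r)) \<le> max_modulus ?r entire_series"
      using elim by (intro max_modulus_ge[OF cont]) (simp add: norm_mult)
    finally have "ln (exp (real (N q))) \<le> ln (max_modulus ?r entire_series)"
      by (rule ln_mono) simp
    then show ?case using N_ge_1[of q] by simp
  qed
qed

lemma entire_series_order_le:
  assumes "\<gamma> > 0" and ev: "eventually (\<lambda>k. real k powr \<gamma> \<le> \<phi> k) sequentially"
  shows "growth_order entire_series \<le> ereal (1 / \<gamma>)"
proof -
  obtain J where J: "\<And>k. k \<ge> J \<Longrightarrow> real k powr \<gamma> \<le> \<phi> k"
    using ev by (auto simp: eventually_sequentially)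
  have "norm (coeff k) \<le> 1 * (1 / real k powr \<gamma>) ^ k" if k: "k \<ge> max J 1" for k
  proof -
    have "0 < real k powr \<gamma>" "real k powr \<gamma> \<le> \<phi> k" "0 < \<phi> k"
      using J[of k] k by (auto intro: less_le_trans[of 0 "real k powr \<gamma>"])
    then have "(1 / \<phi> k) ^ k \<le> (1 / real k powr \<gamma>) ^ k"
      by (intro power_mono frac_le) auto
    then show ?thesis by (auto simp: norm_coeff c\<phi>)
  qed
  moreover have "coeff (N 0) \<noteq> 0" using c_pos[of 0] by (simp add: coeff_N)
  ultimately show ?thesis
    unfolding entire_series_def[abs_def] using N0 assms(1)
    by (intro growth_order_powser_le(3)[of "max J 1" coeff 1 1 \<gamma> "\<lambda>_. 0" "N 0"]) auto
qed

end

end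

text \<open>For fixed K the binomial coefficient is at most j^K. One of the two factors (1/2)^j in
  (1/4)^j beats this power, the other remains as the bound, so every sufficiently large exponent is
  compatible with K.\<close>

lemma lacunary_exists:
  fixes c :: "nat \<Rightarrow> real"
  assumes "eventually (\<lambda>j. 0 < c j \<and> c j \<le> (1/4) ^ j) sequentially"
  obtains N where "lacunary N c"
proof -
  obtain J where J: "\<And>j. j \<ge> J \<Longrightarrow> 0 < c j \<and> c j \<le> (1/4) ^ j"
    using assms by (auto simp: eventually_sequentially)
  have ev: "eventually (\<lambda>j. real (j choose K) * c j \<le> (1/2) ^ j * c K) sequentially" if K: "K \<ge> J" for K
  proof -
    have "(\<lambda>j. real j ^ K * (1/2) ^ j) \<longlonglongrightarrow> 0" by real_asymp
    then have "eventually (\<lambda>j. real j ^ K * (1/2) ^ j < c K) sequentially"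
      using J[OF K] by (intro order_tendstoD) auto
    with eventually_ge_at_top[of "max J K"] show ?thesis
    proof eventually_elim
      case (elim j)
      have "real (j choose K) \<le> real j ^ K"
        using binomial_le_pow[of K j] elim by (metis max.boundedE of_nat_le_iff of_nat_power)
      then have "real (j choose K) * c j \<le> real j ^ K * (1/4) ^ j"
        using J[of j] elim by (intro mult_mono) auto
      also have "\<dots> = (1/2) ^ j * (real j ^ K * (1/2) ^ j)"
        by (simp add: power_divide flip: power_mult_distrib)
      also have "\<dots> \<le> (1/2) ^ j * c K"
        using elim by (intro mult_left_mono) auto
      finally show ?case .
    qed
  qed
  let ?P = "\<lambda>(_::nat) x. x \<ge> max 1 J"
  \<comment> \<open>The condition is imposed for all \<open>K\<close> from \<open>J\<close> to
    \<open>x\<close>, not only for earlier exponents, so that the next choice depends on the last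
    exponent alone.\<close>
  let ?Q = "\<lambda>(_::nat) x y. 2 * x \<le> y \<and> x < y \<and> (\<forall>K\<in>{J..x}. real (y choose K) * c y \<le> (1/2) ^ y * c K)"
  have "\<exists>N. \<forall>q. ?P q (N q) \<and> ?Q q (N q) (N (Suc q))"
  proof (rule dependent_nat_choice)
    fix x :: nat assume x: "max 1 J \<le> x"
    have "eventually (\<lambda>y. \<forall>K\<in>{J..x}. real (y choose K) * c y \<le> (1/2) ^ y * c K) sequentially"
      using ev by (intro eventually_ball_finite) auto
    with eventually_ge_at_top[of "2 * x"]
    have "eventually (\<lambda>y. max 1 J \<le> y \<and> ?Q 0 x y) sequentially"
      by eventually_elim (use x in auto)
    then show "\<exists>y\<ge>max 1 J. ?Q 0 x y"
      using eventually_happens by fastforce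
  qed blast
  then obtain N where N1: "\<And>q. N q \<ge> max 1 J" and Q: "\<And>q. ?Q q (N q) (N (Suc q))"
    by blast
  have mono: "strict_mono N"
    using Q by (auto simp: strict_mono_Suc_iff)
  have "lacunary N c"
  proof
    show "real (N q choose N p) * c (N q) \<le> (1/2) ^ N q * c (N p)" if pq: "p < q" for p q
    proof -
      obtain q' where q': "q = Suc q'" using pq by (cases q) auto
      with pq have "N p \<le> N q'" using mono by (simp add: strict_mono_less_eq)
      with Q[of q'] N1[of p] q' show ?thesis by auto
    qed
  qed (use mono N1 Q J in auto)
  then show ?thesis by (rule that)
qed

lemma lacunary_exists_of_root:
  assumes "eventually (\<lambda>j. \<phi> j \<ge> (4::real)) sequentially"
  obtains N where "lacunary N (\<lambda>k. (1 / \<phi> k) ^ k)"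
proof (rule lacunary_exists)
  show "eventually (\<lambda>j. 0 < (1 / \<phi> j) ^ j \<and> (1 / \<phi> j) ^ j \<le> (1/4) ^ j) sequentially"
    using assms by eventually_elim (auto intro!: power_mono frac_le)
qed

text \<open>\<open>L\<close> yields the lower bound for the order. For the upper bound, \<phi> k
  \<ge> k^(1/s) gives order at most s for every real s above \<rho>.\<close>

lemma exists_order:
  assumes \<rho>: "0 \<le> \<rho>"
  shows "\<exists>f n F. admissible_pair f n \<and> rho_star n = \<infinity> \<and>
           harmonic_entire_extension f F \<and> growth_order F = \<rho>"
proof -
  have main: ?thesis if \<phi>: "filterlim \<phi> at_top sequentially"
    and L: "((\<lambda>k. ereal (ln (real k) / ln (exp 1 * \<phi> k))) \<longlongrightarrow> \<rho>) sequentially"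
    and upper: "\<And>s. \<rho> < ereal s \<Longrightarrow> eventually (\<lambda>k. real k powr (1 / s) \<le> \<phi> k) sequentially" for \<phi>
  proof -
    have "eventually (\<lambda>j. \<phi> j \<ge> 4) sequentially"
      using \<phi> by (simp add: filterlim_at_top)
    then obtain N where N: "lacunary N (\<lambda>k. (1 / \<phi> k) ^ k)"
      by (rule lacunary_exists_of_root)
    interpret lacunary N "\<lambda>k. (1 / \<phi> k) ^ k" by (rule N)
    have "growth_order entire_series \<le> \<rho>"
    proof (rule dense_ge)
      fix s assume s: "\<rho> < s"
      show "growth_order entire_series \<le> s"
      proof (cases s)
        case (real s')
        with s \<rho> have "s' > 0" by (metis ereal_less(2) order.strict_trans1)
        with entire_series_order_le[OF \<phi> refl, of "1 / s'"] upper[of s'] s real show ?thesis by simp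
      qed (use s \<rho> in auto)
    qed
    with entire_series_order_ge[OF \<phi> refl L] have "growth_order entire_series = \<rho>" by simp
    then show ?thesis
      using admissible rho_star_idx harmonic_entire_extension_series[OF \<phi> refl] by blast
  qed
  consider "\<rho> = 0" | r where "\<rho> = ereal r" "r > 0" | "\<rho> = \<infinity>"
    using \<rho> by (cases \<rho>) (auto simp: zero_ereal_def, force)
  then show ?thesis
  proof cases
    case 1
    show ?thesis
    proof (rule main[of "\<lambda>k. exp (real k)"])
      show "filterlim (\<lambda>k. exp (real k)) at_top sequentially" by real_asymp
      have "(\<lambda>k. ln (real k) / ln (exp 1 * exp (real k))) \<longlonglongrightarrow> 0" by real_asymp
      then show "(\<lambda>k. ereal (ln (real k) / ln (exp 1 * exp (real k)))) \<longlonglongrightarrow> \<rho>"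
        by (simp add: 1 zero_ereal_def)
      fix s assume "\<rho> < ereal s"
      then have "1 / s > 0" using 1 by simp
      then show "eventually (\<lambda>k. real k powr (1 / s) \<le> exp (real k)) sequentially"
        by real_asymp
    qed
  next
    case (2 r)
    show ?thesis
    proof (rule main[of "\<lambda>k. real k powr (1 / r)"])
      have "1 / r > 0" using 2 by simp
      then show "filterlim (\<lambda>k. real k powr (1 / r)) at_top sequentially" by real_asymp
      have "(\<lambda>k. ln (real k) / ln (exp 1 * real k powr (1 / r))) \<longlonglongrightarrow> r"
        using 2(2) by real_asymp
      then show "(\<lambda>k. ereal (ln (real k) / ln (exp 1 * real k powr (1 / r)))) \<longlonglongrightarrow> \<rho>"
        by (simp add: 2)
      fix s assume "\<rho> < ereal s"
      then have le: "1 / s \<le> 1 / r" using 2 by (simp add: frac_le)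
      show "eventually (\<lambda>k. real k powr (1 / s) \<le> real k powr (1 / r)) sequentially"
        using eventually_ge_at_top[of 1] by eventually_elim (use le in \<open>auto intro!: powr_mono\<close>)
    qed
  next
    case 3
    show ?thesis
    \<comment> \<open>No real number exceeds \<rho> here, so the upper condition is vacuous.\<close>
    proof (rule main[of "\<lambda>k. ln (real k)"])
      show "filterlim (\<lambda>k. ln (real k)) at_top sequentially" by real_asymp
      have "filterlim (\<lambda>k. ln (real k) / ln (exp 1 * ln (real k))) at_top sequentially" by real_asymp
      then show "(\<lambda>k. ereal (ln (real k) / ln (exp 1 * ln (real k)))) \<longlonglongrightarrow> \<rho>"
        by (simp add: 3 tendsto_PInfty_eq_at_top)
    qed (use 3 in auto)
  qed
qed

theorem theorem9:
  shows
    "(\<forall>f n. admissible_pair f n \<and> rho_star n < \<infinity> \<longrightarrow>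
        (\<exists>F. harmonic_entire_extension f F \<and> growth_order F \<le> rho_star n)) \<and>
     (\<exists>f n. admissible_pair f n \<and> rho_star n = \<infinity> \<and> \<not> harmonic_entire f) \<and>
     (\<forall>\<rho>::ereal. 0 \<le> \<rho> \<longrightarrow>
        (\<exists>f n F. admissible_pair f n \<and> rho_star n = \<infinity> \<and>
           harmonic_entire_extension f F \<and> growth_order F = \<rho>))"
proof (intro conjI)
  show "\<forall>f n. admissible_pair f n \<and> rho_star n < \<infinity> \<longrightarrow>
        (\<exists>F. harmonic_entire_extension f F \<and> growth_order F \<le> rho_star n)"
    using admissible_pair_entire_of_finite_order by blast
  obtain N where N: "lacunary N (\<lambda>k. (1 / 4) ^ k)"
    by (rule lacunary_exists_of_root[of "\<lambda>_. 4"]) auto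
  interpret lacunary N "\<lambda>k. (1 / 4) ^ k" by (rule N)
  show "\<exists>f n. admissible_pair f n \<and> rho_star n = \<infinity> \<and> \<not> harmonic_entire f"
    using admissible rho_star_idx not_entire by blast
  show "\<forall>\<rho>::ereal. 0 \<le> \<rho> \<longrightarrow> (\<exists>f n F. admissible_pair f n \<and> rho_star n = \<infinity> \<and>
           harmonic_entire_extension f F \<and> growth_order F = \<rho>)"
    using exists_order by blast
qed

end
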